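(* Let $D$ be a solid digraph. Then the map $\hat\Phi\colon|D|\to\varprojlim(D/P)_{P\in\mathcal{P}(D)}$, $x\mapsto(\hat\varphi_P(x))_{P\in\mathcal{P}(D)}$, is a homeomorphism.
   Context: Digraphs have no loops and no parallel edges. $\mathcal{X}(D)$: finite subsets of $V(D)$. $D$ is solid if $D-X$ has only finitely many strong components for every $X\in\mathcal{X}(D)$. A vertex set $Y$ separates vertex sets $A,B$ if every $A$–$B$ path meets $Y$ or every $B$–$A$ path meets $Y$. A finite partition $P$ of $V(D)$ is admissible if any two distinct classes are separated by a finite vertex set; $\mathcal{P}(D)$ is the set of admissible partitions, directed by $P\le P'$ iff $P'$ refines $P$. $D/P$ is the finite multi-digraph on $P$ where for distinct $p_1,p_2\in P$ there is one edge $(e,p_1,p_2)$ per edge $e$ of $D$ from $p_1$ to $p_2$ if there are finitely many, and a single quotient edge $(p_1p_2,p_1,p_2)$ if there are infinitely many; it carries the 1-complex topology. For $P\le P'$, $f_{P'P}\colon D/P'\to D/P$ sends $p'$ to the class $p\supseteq p'$; an edge $(e',p_1',p_2')$ with both ends in one class $p$ goes to $p$; otherwise, with $p_1'\subseteq p_1\ne p_2\supseteq p_2'$, it is mapped pointwise onto the quotient edge from $p_1$ to $p_2$ if it exists, else onto $(e',p_1,p_2)$. $\varprojlim(D/P)_{P}$ is the subspace of $\prod_P D/P$ of all $(x_P)$ with $f_{P'P}(x_{P'})=x_P$ whenever $P\le P'$. Ends and limit edges: rays are one-way infinite directed paths, tails are subrays; a ray is solid if for each $X\in\mathcal{X}(D)$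 it has a tail in a strong component of $D-X$; solid rays are equivalent if for each $X$ they have tails in the same strong component; classes are ends, $\Omega(D)$. $C(X,\omega)$: the strong component of $D-X$ containing tails of rays of $\omega$ ($\omega$ lives in it); $X$ separates ends $\omega,\eta$ if $C(X,\omega)\ne C(X,\eta)$. For distinct ends, $(\omega,\eta)$ is a limit edge if for each $X$ separating them $D$ has an edge from $C(X,\omega)$ to $C(X,\eta)$; for a vertex $v$, $(v,\omega)$ (resp. $(\omega,v)$) is a limit edge if $D$ has an edge from $v$ to $C(X,\omega)$ (resp. from $C(X,\omega)$ to $v$) for all $X$ with $v\notin C(X,\omega)$. $\Lambda(D)$: limit edges. $|D|$: from $V(D)\cup\Omega(D)$ and copies $[0,1]_e$, $e\in E(D)\cup\Lambda(D)$, identify the tail of $e$ with $0$ and head with $1$; points on different edges correspond if they come from the same real. A limit edge lives in a strong component $C$ of $D-X$ if each endpoint is a vertex of or an end living in $C$. Topology generated by: (1) open $\varepsilon$-stars around vertices; (2) open subintervals of interiors of edges of $D$; (3) for an end $\omega$ and $X\in\mathcal{X}(D)$, $\hat C_\varepsilon(X,\omega)$: vertices and inner points of edges of $C(X,\omega)$, ends living in $C(X,\omega)$, points of limit edges living in $C(X,\omega)$, and for each edge of $E(D)\cup\Lambda(D)$ with exactly one endpoint $y$ a vertex of/end living in $C(X,\omega)$, the half-open segment of length $\varepsilon$ at $y$; (4) for an inner point $z$ of a limit edge $(\omega,\eta)$ and $X$ separating $\omega,\eta$: union of open $\varepsilon$-intervals around points corresponding to $z$ on all edges of $D$ from $C(X,\omega)$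 to $C(X,\eta)$ and on limit edges with tail a vertex of/end living in $C(X,\omega)$ and head a vertex of/end living in $C(X,\eta)$; for $(v,\omega)$ with $v\in X$ analogously over edges of $D$ from $v$ to $C(X,\omega)$ and limit edges $(v,\omega')$, $\omega'$ living in $C(X,\omega)$; symmetrically for $(\omega,v)$. $\hat\varphi_P\colon|D|\to D/P$: a vertex goes to its class; an inner point of an edge $vw$ of $D$ goes to the class of $v$ if $v,w$ are in one class, else to the corresponding point of the edge of $D/P$ from the class of $v$ to that of $w$ (the copy of $vw$ or the quotient edge); an end $\omega$ goes to the class containing tails of all rays of $\omega$; an inner point of a limit edge $\lambda$ goes to the common image of its endpoints if these coincide, and otherwise to the corresponding point of the quotient edge of $D/P$ between the images of the endpoints in the direction of $\lambda$ (which exists). *)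

theory Defs
  imports "HOL-Analysis.Analysis"
begin

text \<open>A digraph is given by a vertex set V and an edge relation E (no parallel
edges, so edges are ordered pairs); no loops.\<close>

definition digraph :: "'v set \<Rightarrow> ('v \<times> 'v) set \<Rightarrow> bool" where
  "digraph V E \<longleftrightarrow> E \<subseteq> V \<times> V \<and> (\<forall>v. (v, v) \<notin> E)"

definition fin_sets :: "'v set \<Rightarrow> 'v set set" where
  "fin_sets V = {X. X \<subseteq> V \<and> finite X}"

definition reach :: "'v set \<Rightarrow> ('v \<times> 'v) set \<Rightarrow> 'v set \<Rightarrow> 'v \<Rightarrow> 'v \<Rightarrow> bool" where
  "reach V E X u w \<longleftrightarrow> (u, w) \<in> (E \<inter> ((V - X) \<times> (V - X)))\<^sup>*"

definition strong_comps :: "'v set \<Rightarrow> ('v \<times> 'v) set \<Rightarrow> 'v set \<Rightarrow> 'v set set" where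
  "strong_comps V E X =
     {{w \<in> V - X. reach V E X u w \<and> reach V E X w u} | u. u \<in> V - X}"

definition solid :: "'v set \<Rightarrow> ('v \<times> 'v) set \<Rightarrow> bool" where
  "solid V E \<longleftrightarrow> (\<forall>X \<in> fin_sets V. finite (strong_comps V E X))"

definition dpath :: "'v set \<Rightarrow> ('v \<times> 'v) set \<Rightarrow> 'v list \<Rightarrow> bool" where
  "dpath V E ps \<longleftrightarrow> ps \<noteq> [] \<and> distinct ps \<and> set ps \<subseteq> V \<and>
     (\<forall>i. Suc i < length ps \<longrightarrow> (ps ! i, ps ! Suc i) \<in> E)"

definition separates :: "'v set \<Rightarrow> ('v \<times> 'v) set \<Rightarrow> 'v set \<Rightarrow> 'v set \<Rightarrow> 'v set \<Rightarrow> bool" where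
  "separates V E Y A B \<longleftrightarrow>
     (\<forall>ps. dpath V E ps \<and> hd ps \<in> A \<and> last ps \<in> B \<longrightarrow> set ps \<inter> Y \<noteq> {}) \<or>
     (\<forall>ps. dpath V E ps \<and> hd ps \<in> B \<and> last ps \<in> A \<longrightarrow> set ps \<inter> Y \<noteq> {})"

definition ray :: "'v set \<Rightarrow> ('v \<times> 'v) set \<Rightarrow> (nat \<Rightarrow> 'v) \<Rightarrow> bool" where
  "ray V E r \<longleftrightarrow> inj r \<and> (\<forall>n. r n \<in> V) \<and> (\<forall>n. (r n, r (Suc n)) \<in> E)"

definition tail_in :: "(nat \<Rightarrow> 'v) \<Rightarrow> 'v set \<Rightarrow> bool" where
  "tail_in r C \<longleftrightarrow> (\<exists>k. \<forall>n\<ge>k. r n \<in> C)"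

definition solid_ray :: "'v set \<Rightarrow> ('v \<times> 'v) set \<Rightarrow> (nat \<Rightarrow> 'v) \<Rightarrow> bool" where
  "solid_ray V E r \<longleftrightarrow> ray V E r \<and>
     (\<forall>X \<in> fin_sets V. \<exists>C \<in> strong_comps V E X. tail_in r C)"

definition ray_equiv :: "'v set \<Rightarrow> ('v \<times> 'v) set \<Rightarrow> (nat \<Rightarrow> 'v) \<Rightarrow> (nat \<Rightarrow> 'v) \<Rightarrow> bool" where
  "ray_equiv V E r s \<longleftrightarrow> solid_ray V E r \<and> solid_ray V E s \<and>
     (\<forall>X \<in> fin_sets V. \<exists>C \<in> strong_comps V E X. tail_in r C \<and> tail_in s C)"

definition ends :: "'v set \<Rightarrow> ('v \<times> 'v) set \<Rightarrow> (nat \<Rightarrow> 'v) set set" where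
  "ends V E = {{s. ray_equiv V E r s} | r. solid_ray V E r}"

definition comp :: "'v set \<Rightarrow> ('v \<times> 'v) set \<Rightarrow> 'v set \<Rightarrow> (nat \<Rightarrow> 'v) set \<Rightarrow> 'v set" where
  "comp V E X \<omega> = (THE C. C \<in> strong_comps V E X \<and> (\<forall>r \<in> \<omega>. tail_in r C))"

definition has_edge :: "('v \<times> 'v) set \<Rightarrow> 'v set \<Rightarrow> 'v set \<Rightarrow> bool" where
  "has_edge E A B \<longleftrightarrow> (\<exists>u \<in> A. \<exists>w \<in> B. (u, w) \<in> E)"

text \<open>Nodes of |D|: vertices (Inl) and ends (Inr).\<close>
type_synonym 'v node = "'v + (nat \<Rightarrow> 'v) set"

definition limit_edges :: "'v set \<Rightarrow> ('v \<times> 'v) set \<Rightarrow> ('v node \<times> 'v node) set" where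
  "limit_edges V E =
     {(Inr \<omega>, Inr \<eta>) | \<omega> \<eta>. \<omega> \<in> ends V E \<and> \<eta> \<in> ends V E \<and> \<omega> \<noteq> \<eta> \<and>
        (\<forall>X \<in> fin_sets V. comp V E X \<omega> \<noteq> comp V E X \<eta> \<longrightarrow>
           has_edge E (comp V E X \<omega>) (comp V E X \<eta>))}
   \<union> {(Inl v, Inr \<omega>) | v \<omega>. v \<in> V \<and> \<omega> \<in> ends V E \<and>
        (\<forall>X \<in> fin_sets V. v \<notin> comp V E X \<omega> \<longrightarrow> has_edge E {v} (comp V E X \<omega>))}
   \<union> {(Inr \<omega>, Inl v) | v \<omega>. v \<in> V \<and> \<omega> \<in> ends V E \<and>
        (\<forall>X \<in> fin_sets V. v \<notin> comp V E X \<omega> \<longrightarrow> has_edge E (comp V E X \<omega>) {v})}"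

definition all_edges :: "'v set \<Rightarrow> ('v \<times> 'v) set \<Rightarrow> ('v node \<times> 'v node) set" where
  "all_edges V E = {(Inl u, Inl w) | u w. (u, w) \<in> E} \<union> limit_edges V E"

text \<open>Points of |D|: nodes, and inner points of edges at a parameter t in (0,1)
(tail = 0, head = 1).\<close>
datatype 'v dpoint = DNode "'v node" | DInner "'v node \<times> 'v node" real

definition lives_in :: "'v set \<Rightarrow> ('v \<times> 'v) set \<Rightarrow> 'v set \<Rightarrow> 'v set \<Rightarrow> 'v node \<Rightarrow> bool" where
  "lives_in V E X C n = (case n of Inl v \<Rightarrow> v \<in> C
                           | Inr \<eta> \<Rightarrow> \<eta> \<in> ends V E \<and> comp V E X \<eta> = C)"

definition vstar :: "'v set \<Rightarrow> ('v \<times> 'v) set \<Rightarrow> 'v \<Rightarrow> real \<Rightarrow> 'v dpoint set" where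
  "vstar V E v \<epsilon> = insert (DNode (Inl v))
     ({DInner e t | e t. e \<in> all_edges V E \<and> fst e = Inl v \<and> 0 < t \<and> t < \<epsilon>} \<union>
      {DInner e t | e t. e \<in> all_edges V E \<and> snd e = Inl v \<and> 1 - \<epsilon> < t \<and> t < 1})"

definition eint :: "'v \<times> 'v \<Rightarrow> real \<Rightarrow> real \<Rightarrow> 'v dpoint set" where
  "eint e a b = {DInner (Inl (fst e), Inl (snd e)) t | t. a < t \<and> t < b}"

definition endnbhd :: "'v set \<Rightarrow> ('v \<times> 'v) set \<Rightarrow> 'v set \<Rightarrow> (nat \<Rightarrow> 'v) set \<Rightarrow> real \<Rightarrow> 'v dpoint set" where
  "endnbhd V E X \<omega> \<epsilon> = (let C = comp V E X \<omega>; L = lives_in V E X C in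
       {DNode n | n. L n}
     \<union> {DInner e t | e t. e \<in> all_edges V E \<and> L (fst e) \<and> L (snd e) \<and> 0 < t \<and> t < 1}
     \<union> {DInner e t | e t. e \<in> all_edges V E \<and> L (fst e) \<and> \<not> L (snd e) \<and> 0 < t \<and> t < \<epsilon>}
     \<union> {DInner e t | e t. e \<in> all_edges V E \<and> \<not> L (fst e) \<and> L (snd e) \<and> 1 - \<epsilon> < t \<and> t < 1})"

text \<open>(4) neighbourhoods of inner points of limit edges.  For an endpoint of the
limit edge that is a vertex v, the corresponding edges must have that endpoint
equal to v; for an endpoint that is an end \<omega>, their endpoint must be a vertex
of / an end living in C(X,\<omega>).\<close>
definition epred :: "'v set \<Rightarrow> ('v \<times> 'v) set \<Rightarrow> 'v set \<Rightarrow> 'v node \<Rightarrow> 'v node \<Rightarrow> bool" where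
  "epred V E X n = (case n of Inl v \<Rightarrow> (\<lambda>m. m = Inl v)
                         | Inr \<omega> \<Rightarrow> lives_in V E X (comp V E X \<omega>))"

definition lim_adm :: "'v set \<Rightarrow> ('v \<times> 'v) set \<Rightarrow> 'v set \<Rightarrow> 'v node \<times> 'v node \<Rightarrow> bool" where
  "lim_adm V E X l = (case l of
       (Inr \<omega>, Inr \<eta>) \<Rightarrow> comp V E X \<omega> \<noteq> comp V E X \<eta>
     | (Inl v, _) \<Rightarrow> v \<in> X
     | (_, Inl v) \<Rightarrow> v \<in> X)"

definition limnbhd :: "'v set \<Rightarrow> ('v \<times> 'v) set \<Rightarrow> 'v node \<times> 'v node \<Rightarrow> real \<Rightarrow> 'v set \<Rightarrow> real \<Rightarrow> 'v dpoint set" where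
  "limnbhd V E l t0 X \<epsilon> =
     {DInner e t | e t. e \<in> all_edges V E \<and> epred V E X (fst l) (fst e) \<and>
        epred V E X (snd l) (snd e) \<and> 0 < t \<and> t < 1 \<and> \<bar>t - t0\<bar> < \<epsilon>}"

definition gen_sets :: "'v set \<Rightarrow> ('v \<times> 'v) set \<Rightarrow> 'v dpoint set set" where
  "gen_sets V E =
     {vstar V E v \<epsilon> | v \<epsilon>. v \<in> V \<and> 0 < \<epsilon> \<and> \<epsilon> < 1}
   \<union> {eint e a b | e a b. e \<in> E \<and> 0 \<le> a \<and> a < b \<and> b \<le> 1}
   \<union> {endnbhd V E X \<omega> \<epsilon> | X \<omega> \<epsilon>. \<omega> \<in> ends V E \<and> X \<in> fin_sets V \<and> 0 < \<epsilon> \<and> \<epsilon> < 1}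
   \<union> {limnbhd V E l t0 X \<epsilon> | l t0 X \<epsilon>. l \<in> limit_edges V E \<and> 0 < t0 \<and> t0 < 1 \<and>
        X \<in> fin_sets V \<and> lim_adm V E X l \<and> 0 < \<epsilon>}"

definition DTop :: "'v set \<Rightarrow> ('v \<times> 'v) set \<Rightarrow> 'v dpoint topology" where
  "DTop V E = topology_generated_by (gen_sets V E)"

definition is_partition :: "'v set \<Rightarrow> 'v set set \<Rightarrow> bool" where
  "is_partition V P \<longleftrightarrow> finite P \<and> {} \<notin> P \<and> \<Union>P = V \<and>
     (\<forall>p \<in> P. \<forall>q \<in> P. p \<noteq> q \<longrightarrow> p \<inter> q = {})"

definition adm_parts :: "'v set \<Rightarrow> ('v \<times> 'v) set \<Rightarrow> 'v set set set" where
  "adm_parts V E = {P. is_partition V P \<and>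
     (\<forall>p \<in> P. \<forall>q \<in> P. p \<noteq> q \<longrightarrow> (\<exists>Y. finite Y \<and> Y \<subseteq> V \<and> separates V E Y p q))}"

definition refines :: "'v set set \<Rightarrow> 'v set set \<Rightarrow> bool" where
  "refines P' P \<longleftrightarrow> (\<forall>p' \<in> P'. \<exists>p \<in> P. p' \<subseteq> p)"

definition cls :: "'v set set \<Rightarrow> 'v \<Rightarrow> 'v set" where
  "cls P u = (THE p. p \<in> P \<and> u \<in> p)"

definition super :: "'v set set \<Rightarrow> 'v set \<Rightarrow> 'v set" where
  "super P p' = (THE p. p \<in> P \<and> p' \<subseteq> p)"

definition edges_between :: "('v \<times> 'v) set \<Rightarrow> 'v set \<Rightarrow> 'v set \<Rightarrow> ('v \<times> 'v) set" where
  "edges_between E p q = {(u, w) \<in> E. u \<in> p \<and> w \<in> q}"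

text \<open>Edges of D/P: a copy QE e of an edge e of D, or the quotient edge QQ p q.\<close>
datatype 'v qedge = QE "'v \<times> 'v" | QQ "'v set" "'v set"

definition qedges :: "'v set \<Rightarrow> ('v \<times> 'v) set \<Rightarrow> 'v set set \<Rightarrow> 'v qedge set" where
  "qedges V E P =
     {QE (u, w) | u w. (u, w) \<in> E \<and> cls P u \<noteq> cls P w \<and>
        finite (edges_between E (cls P u) (cls P w))}
   \<union> {QQ p q | p q. p \<in> P \<and> q \<in> P \<and> p \<noteq> q \<and> infinite (edges_between E p q)}"

definition qtail :: "'v set set \<Rightarrow> 'v qedge \<Rightarrow> 'v set" where
  "qtail P e = (case e of QE uw \<Rightarrow> cls P (fst uw) | QQ p q \<Rightarrow> p)"

definition qhead :: "'v set set \<Rightarrow> 'v qedge \<Rightarrow> 'v set" where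
  "qhead P e = (case e of QE uw \<Rightarrow> cls P (snd uw) | QQ p q \<Rightarrow> q)"

text \<open>Points of D/P: vertices (classes) and inner points of edges.\<close>
datatype 'v qpoint = QV "'v set" | QI "'v qedge" real

definition qstar :: "'v set \<Rightarrow> ('v \<times> 'v) set \<Rightarrow> 'v set set \<Rightarrow> 'v set \<Rightarrow> real \<Rightarrow> 'v qpoint set" where
  "qstar V E P p \<epsilon> = insert (QV p)
     ({QI e t | e t. e \<in> qedges V E P \<and> qtail P e = p \<and> 0 < t \<and> t < \<epsilon>} \<union>
      {QI e t | e t. e \<in> qedges V E P \<and> qhead P e = p \<and> 1 - \<epsilon> < t \<and> t < 1})"

definition qint :: "'v qedge \<Rightarrow> real \<Rightarrow> real \<Rightarrow> 'v qpoint set" where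
  "qint e a b = {QI e t | t. a < t \<and> t < b}"

text \<open>The 1-complex topology on the finite multi-digraph D/P, generated by
open stars around vertices and open subintervals of edge interiors.\<close>
definition QTop :: "'v set \<Rightarrow> ('v \<times> 'v) set \<Rightarrow> 'v set set \<Rightarrow> 'v qpoint topology" where
  "QTop V E P = topology_generated_by
     ({qstar V E P p \<epsilon> | p \<epsilon>. p \<in> P \<and> 0 < \<epsilon> \<and> \<epsilon> < 1}
      \<union> {qint e a b | e a b. e \<in> qedges V E P \<and> 0 \<le> a \<and> a < b \<and> b \<le> 1})"

definition fmap :: "'v set \<Rightarrow> ('v \<times> 'v) set \<Rightarrow> 'v set set \<Rightarrow> 'v set set \<Rightarrow> 'v qpoint \<Rightarrow> 'v qpoint" where
  "fmap V E P' P x = (case x of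
      QV p' \<Rightarrow> QV (super P p')
    | QI e' t \<Rightarrow> (let p1 = super P (qtail P' e'); p2 = super P (qhead P' e') in
        if p1 = p2 then QV p1
        else if QQ p1 p2 \<in> qedges V E P then QI (QQ p1 p2) t
        else QI e' t))"

definition invlim_top :: "'v set \<Rightarrow> ('v \<times> 'v) set \<Rightarrow> ('v set set \<Rightarrow> 'v qpoint) topology" where
  "invlim_top V E = subtopology (product_topology (\<lambda>P. QTop V E P) (adm_parts V E))
     {x. \<forall>P \<in> adm_parts V E. \<forall>P' \<in> adm_parts V E.
           refines P' P \<longrightarrow> fmap V E P' P (x P') = x P}"

definition nimg :: "'v set set \<Rightarrow> 'v node \<Rightarrow> 'v set" where
  "nimg P n = (case n of Inl v \<Rightarrow> cls P v
                 | Inr \<omega> \<Rightarrow> (THE p. p \<in> P \<and> (\<forall>r \<in> \<omega>. tail_in r p)))"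

definition phi :: "'v set \<Rightarrow> ('v \<times> 'v) set \<Rightarrow> 'v set set \<Rightarrow> 'v dpoint \<Rightarrow> 'v qpoint" where
  "phi V E P x = (case x of
      DNode n \<Rightarrow> QV (nimg P n)
    | DInner e t \<Rightarrow> (let a = nimg P (fst e); b = nimg P (snd e) in
        if a = b then QV a
        else if QQ a b \<in> qedges V E P then QI (QQ a b) t
        else (case e of (Inl u, Inl w) \<Rightarrow> QI (QE (u, w)) t | _ \<Rightarrow> undefined)))"

definition Phi :: "'v set \<Rightarrow> ('v \<times> 'v) set \<Rightarrow> 'v dpoint \<Rightarrow> ('v set set \<Rightarrow> 'v qpoint)" where
  "Phi V E x = restrict (\<lambda>P. phi V E P x) (adm_parts V E)"

end

theory Submission
  imports Defs
begin

text \<open>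
  For a finite vertex set \<open>X\<close> the strong components of \<open>D - X\<close> together with the singletons of \<open>X\<close>
  form an admissible partition \<open>parts X\<close>, and these partitions are cofinal among all admissible ones:
  every admissible partition is refined by \<open>parts X\<close> as soon as \<open>X\<close> contains separators for all
  pairs of its classes. Each generator of the topology of \<open>|D|\<close> is the preimage of an open
  subset of some \<open>D/(parts X)\<close>, so the inverse of \<open>\<Phi>\<close> is continuous without any appeal to compactness.
  Injectivity holds because finite sets separate nodes.

  Surjectivity comes down to directions, that is, monotone choices \<open>f X\<close> of a strong component
  of \<open>D - X\<close>; we need a ray with a tail in every \<open>f X\<close>. Say that \<open>Y\<close> cuts \<open>x\<close> off
  (relative to \<open>X\<close>) if \<open>x\<close> lies in \<open>f X\<close> but neither in \<open>Y\<close> nor in \<open>f (X \<union> Y)\<close>. If some \<open>x\<close> is cut off by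
  infinitely many disjoint finite sets \<open>Y\<^sub>i\<close>, then no vertex \<open>v\<close> lies in infinitely many \<open>f (X \<union> Y\<^sub>i)\<close>,
  because a finite strongly connected set containing \<open>v\<close> and \<open>x\<close> meets only finitely many \<open>Y\<^sub>i\<close>.
  Otherwise the sets cutting off \<open>x\<close> always have a finite hitting set, and a countable set of vertices closed
  under taking hitting sets captures \<open>f\<close>. In both cases one builds a sequence of finite
  strongly connected sets, consecutive ones overlapping, that eventually lies in every \<open>f X\<close>, and Koenig's
  lemma extracts the ray.
\<close>

section \<open>Strong components and admissible partitions\<close>

locale solid_digraph =
  fixes V :: "'v set" and E :: "('v \<times> 'v) set"
  assumes digraph: "digraph V E" and solid: "solid V E"
begin

section \<open>Reachability in \<open>D - X\<close>: walks and directed paths\<close>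

abbreviation rel :: "'v set \<Rightarrow> ('v \<times> 'v) set" where
  "rel X \<equiv> E \<inter> (V - X) \<times> (V - X)"

lemma edge_in: "(u, w) \<in> E \<Longrightarrow> u \<in> V \<and> w \<in> V \<and> u \<noteq> w"
  using digraph unfolding digraph_def by auto

lemma reach_refl: "reach V E X u u"
  unfolding reach_def by simp

lemma reach_trans: "reach V E X u v \<Longrightarrow> reach V E X v w \<Longrightarrow> reach V E X u w"
  unfolding reach_def by (rule rtrancl_trans)

lemma reach_antimono: "X \<subseteq> X' \<Longrightarrow> reach V E X' u w \<Longrightarrow> reach V E X u w"
  unfolding reach_def by (erule rtrancl_mono[THEN subsetD, rotated]) auto

text \<open>The start has to be assumed outside \<open>X\<close> because \<open>reach\<close> is
  reflexive everywhere, even at the deleted vertices.\<close>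

lemma reach_in: "reach V E X u w \<Longrightarrow> u \<in> V - X \<Longrightarrow> w \<in> V - X"
  unfolding reach_def by (induction rule: rtrancl_induct) auto

lemma dpath_reach:
  assumes "dpath V E ps" "set ps \<inter> X = {}"
  shows "reach V E X (hd ps) (last ps)"
  using assms
proof (induction ps)
  case Nil
  then show ?case by (simp add: dpath_def)
next
  case (Cons a ps)
  show ?case
  proof (cases "ps = []")
    case True
    then show ?thesis by (simp add: reach_refl)
  next
    case False
    have "dpath V E ps"
      using Cons.prems(1) False unfolding dpath_def by fastforce
    then have "reach V E X (hd ps) (last ps)"
      using Cons by auto
    moreover have "(a, hd ps) \<in> rel X"
    proof -
      have "((a # ps) ! 0, (a # ps) ! Suc 0) \<in> E"
        using Cons.prems(1) False unfolding dpath_def by (metis One_nat_def Suc_less_eq length_Cons length_greater_0_conv)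
      then have "(a, hd ps) \<in> E"
        using False by (simp add: hd_conv_nth)
      moreover have "hd ps \<in> set ps" using False by simp
      ultimately show ?thesis
        using Cons.prems unfolding dpath_def by auto
    qed
    ultimately show ?thesis
      using False unfolding reach_def by (auto intro: converse_rtrancl_into_rtrancl)
  qed
qed

text \<open>Separation speaks of paths with distinct vertices, strong components of walks; this
  converts a walk into a path. When the walk returns to a vertex already on the path, the path is
  cut back to that vertex.\<close>

lemma reach_dpath:
  assumes "reach V E X u w" "u \<in> V - X"
  shows "\<exists>ps. dpath V E ps \<and> hd ps = u \<and> last ps = w \<and> set ps \<inter> X = {}"
  using assms unfolding reach_def
proof (induction rule: rtrancl_induct)
  case base
  then show ?case by (intro exI[of _ "[u]"]) (auto simp: dpath_def)
next
  case (step y z)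
  then obtain ps where ps: "dpath V E ps" "hd ps = u" "last ps = y" "set ps \<inter> X = {}"
    by auto
  show ?case
  proof (cases "z \<in> set ps")
    case True
    then obtain k where k: "k < length ps" "ps ! k = z"
      by (auto simp: in_set_conv_nth)
    have "dpath V E (take (Suc k) ps)"
      using ps(1) k set_take_subset[of "Suc k" ps] unfolding dpath_def by auto
    moreover have "last (take (Suc k) ps) = z"
      using k by (simp add: take_Suc_conv_app_nth)
    moreover have "hd (take (Suc k) ps) = u"
      using ps k by simp
    moreover have "set (take (Suc k) ps) \<inter> X = {}"
      using ps(4) set_take_subset[of "Suc k" ps] by blast
    ultimately show ?thesis by blast
  next
    case False
    have ne: "ps \<noteq> []" using ps(1) by (simp add: dpath_def)
    have "((ps @ [z]) ! i, (ps @ [z]) ! Suc i) \<in> E" if "Suc i < length (ps @ [z])" for i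
    proof (cases "Suc i < length ps")
      case True
      then show ?thesis using ps(1) unfolding dpath_def by (auto simp: nth_append)
    next
      case F: False
      then have i: "i = length ps - 1" "Suc i = length ps" using that ne by auto
      then have "ps ! i = y" using ps(3) ne by (simp add: last_conv_nth)
      then show ?thesis using i step.hyps(2) by (auto simp: nth_append)
    qed
    then have "dpath V E (ps @ [z])"
      using ps(1) False step.hyps(2) unfolding dpath_def by auto
    then show ?thesis
      using ps ne step.hyps(2) by (intro exI[of _ "ps @ [z]"]) auto
  qed
qed

section \<open>Strong components of \<open>D - X\<close>\<close>

lemma strong_compsE:
  assumes "C \<in> strong_comps V E X" "u \<in> C"
  shows "C = {w \<in> V - X. reach V E X u w \<and> reach V E X w u}" "u \<in> V - X"
  using assms unfolding strong_comps_def by (auto intro: reach_trans)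

lemma strong_comps_disjoint:
  assumes "C \<in> strong_comps V E X" "C' \<in> strong_comps V E X" "C \<inter> C' \<noteq> {}"
  shows "C = C'"
  using assms strong_compsE(1) by blast

lemma strong_comps_nonempty: "C \<in> strong_comps V E X \<Longrightarrow> C \<noteq> {}"
  unfolding strong_comps_def using reach_refl by blast

lemma strong_comps_cover:
  assumes "u \<in> V - X"
  obtains C where "C \<in> strong_comps V E X" "u \<in> C"
proof (rule that)
  show "{w \<in> V - X. reach V E X u w \<and> reach V E X w u} \<in> strong_comps V E X"
    using assms unfolding strong_comps_def by blast
qed (use assms reach_refl in auto)

lemma strong_comps_reach:
  "C \<in> strong_comps V E X \<Longrightarrow> u \<in> C \<Longrightarrow> w \<in> C \<Longrightarrow> reach V E X u w"
  using strong_compsE(1) by blast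

lemma strong_comps_subset: "C \<in> strong_comps V E X \<Longrightarrow> C \<subseteq> V - X"
  using strong_compsE(2) by blast

lemma strong_comps_closed:
  assumes "C \<in> strong_comps V E X" "u \<in> C" "reach V E X u w" "reach V E X w u"
  shows "w \<in> C"
proof -
  have "w \<in> V - X" using reach_in[OF assms(3) strong_compsE(2)[OF assms(1,2)]] .
  then show ?thesis by (subst strong_compsE(1)[OF assms(1,2)]) (simp add: assms(3,4))
qed

section \<open>The admissible partitions \<open>parts X\<close> and their cofinality\<close>

definition parts :: "'v set \<Rightarrow> 'v set set" where
  "parts X = strong_comps V E X \<union> (\<lambda>x. {x}) ` X"

text \<open>Solidity of \<open>D\<close> enters here: it bounds the number of strong components, so
  the partition is finite.\<close>

lemma parts_partition:
  assumes "X \<in> fin_sets V"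
  shows "is_partition V (parts X)"
proof -
  have "finite (parts X)"
    using solid assms unfolding solid_def parts_def fin_sets_def by auto
  moreover have "{} \<notin> parts X"
    using strong_comps_nonempty unfolding parts_def by auto
  moreover have "\<Union>(parts X) = V"
  proof
    show "\<Union>(parts X) \<subseteq> V"
      using strong_comps_subset assms unfolding parts_def fin_sets_def by auto
    show "V \<subseteq> \<Union>(parts X)"
    proof
      fix v assume "v \<in> V"
      then show "v \<in> \<Union>(parts X)"
        using strong_comps_cover[of v X] by (cases "v \<in> X") (auto simp: parts_def)
    qed
  qed
  moreover have "p \<inter> q = {}" if "p \<in> parts X" "q \<in> parts X" "p \<noteq> q" for p q
    using that strong_comps_disjoint[of p X q] strong_comps_subset[of p X] strong_comps_subset[of q X]
    unfolding parts_def by auto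
  ultimately show ?thesis unfolding is_partition_def by blast
qed

lemma partition_eqI:
  "is_partition V P \<Longrightarrow> p \<in> P \<Longrightarrow> q \<in> P \<Longrightarrow> x \<in> p \<Longrightarrow> x \<in> q \<Longrightarrow> p = q"
  unfolding is_partition_def by blast

lemma partition_nonempty: "is_partition V P \<Longrightarrow> p \<in> P \<Longrightarrow> \<exists>u. u \<in> p \<and> u \<in> V"
  unfolding is_partition_def by (metis Union_iff all_not_in_conv)

lemma partition_cover: "is_partition V P \<Longrightarrow> u \<in> V \<Longrightarrow> \<exists>p\<in>P. u \<in> p"
  unfolding is_partition_def by (metis Union_iff)

lemma partition_subset: "is_partition V P \<Longrightarrow> p \<in> P \<Longrightarrow> p \<subseteq> V"
  unfolding is_partition_def by (metis Union_upper)

lemma dpath_ends: "dpath V E ps \<Longrightarrow> hd ps \<in> set ps \<and> last ps \<in> set ps"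
  unfolding dpath_def by simp

text \<open>Distinct strong components are separated by \<open>X\<close> itself, since paths in both
  directions avoiding \<open>X\<close> would merge them. A singleton class \<open>{x}\<close> is
  separated from any other class by \<open>{x}\<close>, because every path between the two has
  \<open>x\<close> as an endpoint.\<close>

lemma parts_adm:
  assumes "X \<in> fin_sets V"
  shows "parts X \<in> adm_parts V E"
proof -
  have "\<exists>Y. finite Y \<and> Y \<subseteq> V \<and> separates V E Y p q"
    if pq: "p \<in> parts X" "q \<in> parts X" "p \<noteq> q" for p q
  proof (cases "p \<in> strong_comps V E X \<and> q \<in> strong_comps V E X")
    case True
    have "separates V E X p q"
    proof (rule ccontr)
      assume "\<not> separates V E X p q"
      then obtain ps qs where
        ps: "dpath V E ps" "hd ps \<in> p" "last ps \<in> q" "set ps \<inter> X = {}" and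
        qs: "dpath V E qs" "hd qs \<in> q" "last qs \<in> p" "set qs \<inter> X = {}"
        unfolding separates_def by blast
      have "reach V E X (last ps) (hd ps)"
        using dpath_reach[OF qs(1,4)] True ps qs strong_comps_reach reach_trans by metis
      then have "last ps \<in> p"
        using strong_comps_closed True ps(2) dpath_reach[OF ps(1,4)] by blast
      then show False
        using True ps(3) pq(3) strong_comps_disjoint by blast
    qed
    then show ?thesis using assms unfolding fin_sets_def by auto
  next
    case False
    then consider x where "x \<in> X" "p = {x}" | x where "x \<in> X" "q = {x}"
      using pq unfolding parts_def by auto
    then obtain x where "x \<in> X" "p = {x} \<or> q = {x}" by metis
    then have "separates V E {x} p q"
      unfolding separates_def using dpath_ends by fastforce
    then show ?thesis using assms \<open>x \<in> X\<close> unfolding fin_sets_def by blast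
  qed
  then show ?thesis
    using parts_partition[OF assms] unfolding adm_parts_def by blast
qed

lemma adm_partition: "P \<in> adm_parts V E \<Longrightarrow> is_partition V P"
  unfolding adm_parts_def by blast

text \<open>\<open>X\<close> is the union of separators chosen for all pairs of classes. Two
  vertices of one strong component of \<open>D - X'\<close> are joined both ways by paths avoiding
  these separators, so they share a class. Allowing every larger \<open>X'\<close> lets later
  arguments add further vertices without losing the refinement.\<close>

lemma parts_cofinal:
  assumes "P \<in> adm_parts V E"
  obtains X where "X \<in> fin_sets V" "\<And>X'. X' \<in> fin_sets V \<Longrightarrow> X \<subseteq> X' \<Longrightarrow> refines (parts X') P"
proof -
  have part: "is_partition V P" by (rule adm_partition[OF assms])
  define Y where "Y p q = (SOME Y. finite Y \<and> Y \<subseteq> V \<and> separates V E Y p q)" for p q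
  have Y: "finite (Y p q) \<and> Y p q \<subseteq> V \<and> separates V E (Y p q) p q"
    if "p \<in> P" "q \<in> P" "p \<noteq> q" for p q
  proof -
    have "\<exists>Y. finite Y \<and> Y \<subseteq> V \<and> separates V E Y p q"
      using assms that unfolding adm_parts_def by simp
    then show ?thesis unfolding Y_def by (rule someI_ex)
  qed
  define X where "X = (\<Union>p\<in>P. \<Union>q\<in>P - {p}. Y p q)"
  have "finite P" using part by (simp add: is_partition_def)
  then have fin: "X \<in> fin_sets V"
    unfolding X_def fin_sets_def mem_Collect_eq
  proof (intro conjI UN_least finite_UN_I)
    fix p q assume "p \<in> P" "q \<in> P - {p}"
    then have "p \<in> P" "q \<in> P" "p \<noteq> q" by auto
    from Y[OF this] show "Y p q \<subseteq> V" "finite (Y p q)" by auto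
  qed auto
  have sub: "Y p q \<subseteq> X" if "p \<in> P" "q \<in> P" "p \<noteq> q" for p q
    unfolding X_def using that by auto
  have "refines (parts X') P" if X': "X' \<in> fin_sets V" "X \<subseteq> X'" for X'
    unfolding refines_def
  proof
    fix c assume c: "c \<in> parts X'"
    have cV: "c \<subseteq> V" by (rule partition_subset[OF parts_partition[OF X'(1)] c])
    obtain u where u: "u \<in> c" "u \<in> V"
      using partition_nonempty[OF parts_partition[OF X'(1)] c] by auto
    obtain p where p: "p \<in> P" "u \<in> p" using partition_cover[OF part u(2)] by auto
    have "c \<subseteq> p"
    proof
      fix w assume w: "w \<in> c"
      show "w \<in> p"
      proof (cases "w = u")
        case False
        then have C: "c \<in> strong_comps V E X'" using u w c unfolding parts_def by auto
        obtain q where q: "q \<in> P" "w \<in> q"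
          using partition_cover[OF part, of w] w cV by auto
        show ?thesis
        proof (rule ccontr)
          assume "w \<notin> p"
          then have "p \<noteq> q" using q by auto
          obtain ps where ps: "dpath V E ps" "hd ps = u" "last ps = w" "set ps \<inter> X' = {}"
            using reach_dpath strong_comps_reach[OF C u(1) w] strong_compsE(2)[OF C u(1)] by metis
          obtain qs where qs: "dpath V E qs" "hd qs = w" "last qs = u" "set qs \<inter> X' = {}"
            using reach_dpath strong_comps_reach[OF C w u(1)] strong_compsE(2)[OF C w] by metis
          have "separates V E (Y p q) p q" "Y p q \<subseteq> X'"
            using Y[OF p(1) q(1) \<open>p \<noteq> q\<close>] sub[OF p(1) q(1) \<open>p \<noteq> q\<close>] X'(2) by auto
          moreover have "set ps \<inter> Y p q = {}" "set qs \<inter> Y p q = {}"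
            using calculation(2) ps(4) qs(4) by auto
          ultimately show False
            using ps(1-3) qs(1-3) p(2) q(2) unfolding separates_def by (metis (no_types))
        qed
      qed (use p in simp)
    qed
    then show "\<exists>p\<in>P. c \<subseteq> p" using p by blast
  qed
  then show thesis using that fin by blast
qed

text \<open>A class that is not a singleton is a strong component of \<open>D - X'\<close>, and its
  vertices reach each other in the larger digraph \<open>D - X\<close> as well.\<close>

lemma parts_mono:
  assumes "X \<subseteq> X'" "X' \<in> fin_sets V"
  shows "refines (parts X') (parts X)"
  unfolding refines_def
proof
  fix c assume c: "c \<in> parts X'"
  have X: "X \<in> fin_sets V" using assms finite_subset unfolding fin_sets_def by auto
  obtain u where u: "u \<in> c" "u \<in> V"
    using partition_nonempty[OF parts_partition[OF assms(2)] c] by auto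
  obtain p where p: "p \<in> parts X" "u \<in> p"
    using partition_cover[OF parts_partition[OF X] u(2)] by auto
  show "\<exists>p\<in>parts X. c \<subseteq> p"
  proof (cases "c = {u}")
    case False
    then have C: "c \<in> strong_comps V E X'" using c u unfolding parts_def by auto
    then have "u \<notin> X" using strong_comps_subset u assms by blast
    then have pC: "p \<in> strong_comps V E X" using p unfolding parts_def by auto
    have "c \<subseteq> p"
      using strong_comps_closed[OF pC p(2)] strong_comps_reach[OF C] reach_antimono[OF assms(1)] u(1)
      by blast
    then show ?thesis using p by blast
  qed (use p in auto)
qed

section \<open>Evaluating the description operators \<open>cls\<close> and
  \<open>super\<close>\<close>

lemma cls_eq:
  assumes "is_partition V P" "p \<in> P" "u \<in> p"
  shows "cls P u = p"
  unfolding cls_def using assms partition_eqI[OF assms(1)] by (intro the_equality) auto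

lemma cls_in:
  assumes "is_partition V P" "u \<in> V"
  shows "cls P u \<in> P" "u \<in> cls P u"
  using partition_cover[OF assms] cls_eq[OF assms(1)] by auto

lemma super_eq:
  assumes "is_partition V P'" "is_partition V P" "p' \<in> P'" "p \<in> P" "p' \<subseteq> p"
  shows "super P p' = p"
proof -
  obtain x where "x \<in> p'" using partition_nonempty[OF assms(1,3)] by auto
  then show ?thesis
    unfolding super_def
    using assms(4,5) partition_eqI[OF assms(2)] by (intro the_equality) (simp, meson subsetD)
qed

lemma super_in:
  assumes "is_partition V P'" "is_partition V P" "refines P' P" "p' \<in> P'"
  shows "super P p' \<in> P" "p' \<subseteq> super P p'"
proof -
  obtain p where "p \<in> P" "p' \<subseteq> p" using assms(3,4) unfolding refines_def by auto
  then show "super P p' \<in> P" "p' \<subseteq> super P p'" using super_eq[OF assms(1,2,4)] by auto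
qed

end

section \<open>Ends and the classes of nodes\<close>

lemma tail_in_mono: "tail_in r A \<Longrightarrow> A \<subseteq> B \<Longrightarrow> tail_in r B"
  unfolding tail_in_def by blast

text \<open>Disjoint sets cannot both contain a tail of one ray. This gives uniqueness in the
  definitions of \<open>comp\<close> and of \<open>nimg\<close> at ends.\<close>

lemma tail_in_common:
  assumes "tail_in r A" "tail_in r B"
  shows "\<exists>u. u \<in> A \<and> u \<in> B"
proof -
  obtain k l where "\<forall>n\<ge>k. r n \<in> A" "\<forall>n\<ge>l. r n \<in> B"
    using assms unfolding tail_in_def by blast
  then have "r (max k l) \<in> A" "r (max k l) \<in> B" by auto
  then show ?thesis by blast
qed

context solid_digraph
begin

section \<open>Ends and the components in which they live\<close>

lemma endE:
  assumes "\<omega> \<in> ends V E"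
  obtains r where "solid_ray V E r" "\<omega> = {s. ray_equiv V E r s}" "r \<in> \<omega>"
proof -
  obtain r where r: "solid_ray V E r" "\<omega> = {s. ray_equiv V E r s}"
    using assms unfolding ends_def by auto
  moreover have "ray_equiv V E r r" using r(1) unfolding ray_equiv_def solid_ray_def by auto
  ultimately show thesis using that by blast
qed

text \<open>Equivalence gives a component that holds tails of both the representative and the given
  ray. Components holding tails of the same ray coincide, so one component serves the whole
  class.\<close>

lemma end_comp_ex:
  assumes "\<omega> \<in> ends V E" "X \<in> fin_sets V"
  shows "\<exists>C\<in>strong_comps V E X. \<forall>r\<in>\<omega>. tail_in r C"
proof -
  obtain r where r: "solid_ray V E r" "\<omega> = {s. ray_equiv V E r s}"
    using endE[OF assms(1)] by metis
  then obtain C where C: "C \<in> strong_comps V E X" "tail_in r C"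
    using assms(2) unfolding solid_ray_def by blast
  have "tail_in s C" if "s \<in> \<omega>" for s
  proof -
    have "ray_equiv V E r s" using that r(2) by simp
    then obtain C' where C': "C' \<in> strong_comps V E X" "tail_in r C'" "tail_in s C'"
      using assms(2) unfolding ray_equiv_def by blast
    obtain u where "u \<in> C" "u \<in> C'" using tail_in_common[OF C(2) C'(2)] by blast
    then have "C = C'" using strong_comps_disjoint[OF C(1) C'(1)] by auto
    then show ?thesis using C' by simp
  qed
  then show ?thesis using C by blast
qed

text \<open>A single ray already pins down the component, although \<open>comp\<close> quantifies
  over all rays of the end.\<close>

lemma comp_eqI:
  assumes "\<omega> \<in> ends V E" "C \<in> strong_comps V E X" "X \<in> fin_sets V" "r \<in> \<omega>" "tail_in r C"
  shows "comp V E X \<omega> = C"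
proof -
  have *: "C' = C''"
    if "C' \<in> strong_comps V E X \<and> tail_in r C'" "C'' \<in> strong_comps V E X \<and> tail_in r C''" for C' C''
    using that tail_in_common[of r C' C''] strong_comps_disjoint[of C' X C''] by auto
  obtain C0 where C0: "C0 \<in> strong_comps V E X" "\<forall>r\<in>\<omega>. tail_in r C0"
    using end_comp_ex[OF assms(1,3)] by auto
  then have "C0 = C" using *[of C0 C] assms by simp
  then show ?thesis
    unfolding comp_def using C0 assms(4) * by (intro the_equality) simp_all
qed

lemma comp_spec:
  assumes "\<omega> \<in> ends V E" "X \<in> fin_sets V"
  shows "comp V E X \<omega> \<in> strong_comps V E X" "\<And>r. r \<in> \<omega> \<Longrightarrow> tail_in r (comp V E X \<omega>)"
proof -
  obtain r where r: "r \<in> \<omega>" using endE[OF assms(1)] by metis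
  obtain C where C: "C \<in> strong_comps V E X" "\<forall>r\<in>\<omega>. tail_in r C"
    using end_comp_ex[OF assms] by auto
  then have "comp V E X \<omega> = C" using comp_eqI[OF assms(1) C(1) assms(2) r] r by simp
  then show "comp V E X \<omega> \<in> strong_comps V E X" "\<And>r. r \<in> \<omega> \<Longrightarrow> tail_in r (comp V E X \<omega>)"
    using C by simp_all
qed

text \<open>Equality of all components makes every ray of \<omega> equivalent to a representative of
  \<eta>. With the symmetric inclusion, an end is determined by its components.\<close>

lemma end_subset:
  assumes "\<omega> \<in> ends V E" "\<eta> \<in> ends V E" "\<And>X. X \<in> fin_sets V \<Longrightarrow> comp V E X \<omega> = comp V E X \<eta>"
  shows "\<omega> \<subseteq> \<eta>"
proof
  fix s assume s: "s \<in> \<omega>"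
  obtain r where r: "solid_ray V E r" "\<eta> = {s. ray_equiv V E r s}" "r \<in> \<eta>"
    using endE[OF assms(2)] by metis
  have "solid_ray V E s"
    using endE[OF assms(1)] s unfolding ray_equiv_def by blast
  moreover have "\<exists>C\<in>strong_comps V E X. tail_in r C \<and> tail_in s C" if "X \<in> fin_sets V" for X
    using comp_spec[OF assms(1) that] comp_spec[OF assms(2) that] assms(3)[OF that] s r(3) by metis
  ultimately show "s \<in> \<eta>" using r unfolding ray_equiv_def by simp
qed

lemma ends_eqI:
  assumes "\<omega> \<in> ends V E" "\<eta> \<in> ends V E" "\<And>X. X \<in> fin_sets V \<Longrightarrow> comp V E X \<omega> = comp V E X \<eta>"
  shows "\<omega> = \<eta>"
  using end_subset[OF assms] end_subset[OF assms(2,1)] assms(3) by auto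

section \<open>Nodes and their classes in admissible partitions\<close>

definition nodes :: "'v node set" where
  "nodes = Inl ` V \<union> Inr ` ends V E"

lemma nimg_Inl: "nimg P (Inl v) = cls P v"
  by (simp add: nimg_def)

lemma fin_sets_Un: "X \<in> fin_sets V \<Longrightarrow> Y \<in> fin_sets V \<Longrightarrow> X \<union> Y \<in> fin_sets V"
  unfolding fin_sets_def by auto

text \<open>By cofinality some component \<open>comp V E X \<omega>\<close> lies inside a class of
  \<open>P\<close>, and the rays of \<omega> have tails in that component.\<close>

lemma end_class_ex:
  assumes "P \<in> adm_parts V E" "\<omega> \<in> ends V E"
  shows "\<exists>p\<in>P. \<forall>r\<in>\<omega>. tail_in r p"
proof -
  obtain X where X: "X \<in> fin_sets V" "refines (parts X) P"
    using parts_cofinal[OF assms(1)] by (metis subset_refl)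
  note C = comp_spec[OF assms(2) X(1)]
  obtain p where "p \<in> P" "comp V E X \<omega> \<subseteq> p"
    using X(2) C(1) unfolding refines_def parts_def by auto
  then show ?thesis using C(2) tail_in_mono by blast
qed

lemma nimg_Inr_eqI:
  assumes "P \<in> adm_parts V E" "\<omega> \<in> ends V E" "p \<in> P" "r \<in> \<omega>" "tail_in r p"
  shows "nimg P (Inr \<omega>) = p"
proof -
  have *: "q = q'" if "q \<in> P \<and> tail_in r q" "q' \<in> P \<and> tail_in r q'" for q q'
    using that tail_in_common[of r q q'] partition_eqI[OF adm_partition[OF assms(1)]] by auto
  obtain q where q: "q \<in> P" "\<forall>r\<in>\<omega>. tail_in r q"
    using end_class_ex[OF assms(1,2)] by auto
  then have "q = p" using *[of q p] assms by simp
  then show ?thesis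
    unfolding nimg_def using q assms(4) * by (auto intro!: the_equality)
qed

lemma nimg_Inr_spec:
  assumes "P \<in> adm_parts V E" "\<omega> \<in> ends V E"
  shows "nimg P (Inr \<omega>) \<in> P" "\<And>r. r \<in> \<omega> \<Longrightarrow> tail_in r (nimg P (Inr \<omega>))"
proof -
  obtain r where r: "r \<in> \<omega>" using endE[OF assms(2)] by metis
  obtain q where q: "q \<in> P" "\<forall>r\<in>\<omega>. tail_in r q"
    using end_class_ex[OF assms(1,2)] by auto
  then have "nimg P (Inr \<omega>) = q" using nimg_Inr_eqI[OF assms q(1) r] r by simp
  then show "nimg P (Inr \<omega>) \<in> P" "\<And>r. r \<in> \<omega> \<Longrightarrow> tail_in r (nimg P (Inr \<omega>))"
    using q by auto
qed

lemma nimg_in: "P \<in> adm_parts V E \<Longrightarrow> n \<in> nodes \<Longrightarrow> nimg P n \<in> P"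
  unfolding nodes_def using nimg_Inr_spec(1) cls_in(1)[OF adm_partition]
  by (auto simp: nimg_Inl)

lemma nimg_refines:
  assumes "P \<in> adm_parts V E" "P' \<in> adm_parts V E" "refines P' P" "n \<in> nodes"
  shows "nimg P' n \<subseteq> nimg P n"
proof -
  note part = adm_partition[OF assms(1)] adm_partition[OF assms(2)]
  obtain p where p: "p \<in> P" "nimg P' n \<subseteq> p"
    using assms(3) nimg_in[OF assms(2,4)] unfolding refines_def by auto
  have "nimg P n = p"
  proof (cases n)
    case (Inl v)
    then have "v \<in> V" using assms(4) unfolding nodes_def by auto
    then have "v \<in> p" using p(2) cls_in(2)[OF part(2)] by (auto simp: Inl nimg_Inl)
    then show ?thesis using cls_eq[OF part(1) p(1)] by (simp add: Inl nimg_Inl)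
  next
    case (Inr \<omega>)
    then have \<omega>: "\<omega> \<in> ends V E" using assms(4) unfolding nodes_def by auto
    obtain r where r: "r \<in> \<omega>" using endE[OF \<omega>] by metis
    have "tail_in r p" using tail_in_mono nimg_Inr_spec(2)[OF assms(2) \<omega> r] p(2) Inr by auto
    then show ?thesis using nimg_Inr_eqI[OF assms(1) \<omega> p(1) r] Inr by simp
  qed
  then show ?thesis using p by simp
qed

text \<open>On nodes, this is the compatibility of the quotient maps with the bonding maps
  \<open>fmap\<close>.\<close>

lemma super_nimg:
  assumes "P \<in> adm_parts V E" "P' \<in> adm_parts V E" "refines P' P" "n \<in> nodes"
  shows "super P (nimg P' n) = nimg P n"
  using super_eq[OF adm_partition[OF assms(2)] adm_partition[OF assms(1)]] nimg_in nimg_refines assms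
  by simp

lemma nimg_parts_end:
  assumes "X \<in> fin_sets V" "\<omega> \<in> ends V E"
  shows "nimg (parts X) (Inr \<omega>) = comp V E X \<omega>"
proof -
  obtain r where r: "r \<in> \<omega>" using endE[OF assms(2)] by metis
  show ?thesis
    using nimg_Inr_eqI[OF parts_adm[OF assms(1)] assms(2) _ r] comp_spec[OF assms(2,1)] r
    unfolding parts_def by auto
qed

text \<open>Putting a vertex into \<open>X\<close> isolates it, and no end falls into its class
  because components of \<open>D - X\<close> avoid \<open>X\<close>. Adding a vertex to
  \<open>X\<close> is the standard way below to recognise it from its class.\<close>

lemma nimg_parts_vertex:
  assumes "X \<in> fin_sets V" "x \<in> X" "n \<in> nodes"
  shows "nimg (parts X) n = {x} \<longleftrightarrow> n = Inl x"
proof -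
  note part = parts_partition[OF assms(1)]
  have x: "{x} \<in> parts X" using assms(2) unfolding parts_def by auto
  show ?thesis
  proof (cases n)
    case (Inl v)
    then have "v \<in> V" using assms(3) unfolding nodes_def by auto
    then show ?thesis
      using cls_eq[OF part x] cls_in(2)[OF part \<open>v \<in> V\<close>] by (auto simp: Inl nimg_Inl)
  next
    case (Inr \<omega>)
    then have \<omega>: "\<omega> \<in> ends V E" using assms(3) unfolding nodes_def by auto
    have "comp V E X \<omega> \<subseteq> V - X" using comp_spec[OF \<omega> assms(1)] strong_comps_subset by simp
    then show ?thesis using Inr nimg_parts_end[OF assms(1) \<omega>] assms(2) by auto
  qed
qed

text \<open>The topology of |D| is phrased through components; this rewrites it through classes, the
  form in which generators become preimages.\<close>

lemma lives_in_iff: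
  assumes "X \<in> fin_sets V" "C \<in> strong_comps V E X"
  shows "lives_in V E X C n \<longleftrightarrow> n \<in> nodes \<and> nimg (parts X) n = C"
proof (cases n)
  case (Inl v)
  have C: "C \<in> parts X" using assms(2) unfolding parts_def by auto
  have "C \<subseteq> V" using strong_comps_subset[OF assms(2)] by auto
  then show ?thesis
    using Inl cls_eq[OF parts_partition[OF assms(1)] C] cls_in(2)[OF parts_partition[OF assms(1)]]
    unfolding nodes_def lives_in_def by (auto simp: nimg_Inl)
next
  case (Inr \<omega>)
  then show ?thesis
    unfolding nodes_def lives_in_def using nimg_parts_end[OF assms(1)] by auto
qed

text \<open>A vertex is separated from every other node by its own singleton, and two distinct ends
  differ in some component by \<open>ends_eqI\<close>.\<close>

lemma separate_nodes:
  assumes "n \<in> nodes" "m \<in> nodes" "n \<noteq> m"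
  obtains X where "X \<in> fin_sets V" "nimg (parts X) n \<noteq> nimg (parts X) m"
proof -
  have *: "\<exists>X\<in>fin_sets V. nimg (parts X) (Inl v) \<noteq> nimg (parts X) k"
    if "Inl v \<in> nodes" "k \<in> nodes" "k \<noteq> Inl v" for v k
  proof -
    have X: "{v} \<in> fin_sets V" using that(1) unfolding nodes_def fin_sets_def by auto
    show ?thesis
      using nimg_parts_vertex[OF X, of v] that by (intro bexI[OF _ X]) auto
  qed
  have "\<exists>X\<in>fin_sets V. nimg (parts X) n \<noteq> nimg (parts X) m"
  proof (cases n)
    case (Inl v)
    then show ?thesis using * assms by auto
  next
    case n: (Inr \<omega>)
    show ?thesis
    proof (cases m)
      case (Inl v)
      then show ?thesis using *[of v n] assms by metis
    next
      case (Inr \<eta>)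
      have e: "\<omega> \<in> ends V E" "\<eta> \<in> ends V E" "\<omega> \<noteq> \<eta>"
        using assms n Inr unfolding nodes_def by auto
      then obtain X where "X \<in> fin_sets V" "comp V E X \<omega> \<noteq> comp V E X \<eta>"
        using ends_eqI by metis
      then show ?thesis using nimg_parts_end e n Inr by auto
    qed
  qed
  then show thesis using that by blast
qed

section \<open>Limit edges lie over quotient edges\<close>

lemma all_edges_nodes:
  assumes "(n, m) \<in> all_edges V E"
  shows "n \<in> nodes" "m \<in> nodes" "n \<noteq> m"
  using assms edge_in unfolding all_edges_def limit_edges_def nodes_def by auto

text \<open>If there were finitely many edges between the two classes, delete all their endpoints
  together with a set that makes the partition refine \<open>P\<close>. The limit edge still
  provides an edge of \<open>D\<close> between the remaining components, or between a component and
  the given vertex. This edge runs between the two classes but has an endpoint that was not among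
  those deleted.\<close>

lemma limit_edge_infinite:
  assumes "(n, m) \<in> limit_edges V E" "P \<in> adm_parts V E" "nimg P n \<noteq> nimg P m"
  shows "infinite (edges_between E (nimg P n) (nimg P m))"
proof
  assume fin: "finite (edges_between E (nimg P n) (nimg P m))"
  define Y where "Y = fst ` edges_between E (nimg P n) (nimg P m) \<union> snd ` edges_between E (nimg P n) (nimg P m)"
  have Y: "Y \<in> fin_sets V"
    using fin edge_in unfolding Y_def fin_sets_def edges_between_def by auto
  obtain X0 where X0: "X0 \<in> fin_sets V"
    "\<And>X'. X' \<in> fin_sets V \<Longrightarrow> X0 \<subseteq> X' \<Longrightarrow> refines (parts X') P"
    using parts_cofinal[OF assms(2)] by blast
  define X where "X = X0 \<union> Y"
  have X: "X \<in> fin_sets V" using fin_sets_Un[OF X0(1) Y] unfolding X_def .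
  have ref: "refines (parts X) P" using X0(2)[OF X] unfolding X_def by simp
  have sub: "comp V E X \<omega> \<subseteq> nimg P (Inr \<omega>)" "comp V E X \<omega> \<inter> Y = {}" if "\<omega> \<in> ends V E" for \<omega>
    using nimg_refines[OF assms(2) parts_adm[OF X] ref, of "Inr \<omega>"] that nimg_parts_end[OF X that]
      strong_comps_subset[OF comp_spec(1)[OF that X]]
    unfolding nodes_def X_def by auto
  \<comment> \<open>One endpoint outside \<open>Y\<close> suffices. In the cases with a vertex
    \<open>v\<close>, nothing prevents \<open>v\<close> from lying in \<open>Y\<close>, but the
    other endpoint lies in a component avoiding \<open>Y\<close>.\<close>
  have no: False if "u \<in> nimg P n" "w \<in> nimg P m" "(u, w) \<in> E" "u \<notin> Y \<or> w \<notin> Y" for u w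
  proof -
    have "(u, w) \<in> edges_between E (nimg P n) (nimg P m)"
      using that unfolding edges_between_def by simp
    then have "u \<in> Y" "w \<in> Y" unfolding Y_def by force+
    then show False using that by simp
  qed
  have dis: "nimg P n \<inter> nimg P m = {}"
  proof -
    have "n \<in> nodes" "m \<in> nodes" using all_edges_nodes assms(1) unfolding all_edges_def by blast+
    then have "nimg P n \<in> P" "nimg P m \<in> P" using nimg_in[OF assms(2)] by auto
    then show ?thesis using partition_eqI[OF adm_partition[OF assms(2)]] assms(3) by auto
  qed
  have self: "v \<in> nimg P (Inl v)" if "v \<in> V" for v
    using cls_in(2)[OF adm_partition[OF assms(2)] that] by (simp add: nimg_Inl)
  from assms(1) show False
    unfolding limit_edges_def
  proof (elim UnE CollectE exE conjE, goal_cases)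
    case ee: (1 \<omega> \<eta>)
    obtain x where "x \<in> comp V E X \<omega>"
      using strong_comps_nonempty comp_spec(1)[OF ee(2) X] by blast
    then have "comp V E X \<omega> \<noteq> comp V E X \<eta>"
      using sub(1)[OF ee(2)] sub(1)[OF ee(3)] dis ee(1) by auto
    with ee(5) X have "has_edge E (comp V E X \<omega>) (comp V E X \<eta>)" by simp
    then show False
      using no sub[OF ee(2)] sub[OF ee(3)] ee(1) unfolding has_edge_def by blast
  next
    case ve: (2 v \<omega>)
    have "v \<notin> comp V E X \<omega>" using sub(1)[OF ve(3)] self[OF ve(2)] dis ve(1) by auto
    with ve(4) X have "has_edge E {v} (comp V E X \<omega>)" by simp
    then show False
      using no sub[OF ve(3)] self[OF ve(2)] ve(1) unfolding has_edge_def by blast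
  next
    case ev: (3 v \<omega>)
    have "v \<notin> comp V E X \<omega>" using sub(1)[OF ev(3)] self[OF ev(2)] dis ev(1) by auto
    with ev(4) X have "has_edge E (comp V E X \<omega>) {v}" by simp
    then show False
      using no sub[OF ev(3)] self[OF ev(2)] ev(1) unfolding has_edge_def by blast
  qed
qed

end

section \<open>The maps into the finite quotients\<close>

context solid_digraph
begin

text \<open>The carrier of |D|. The datatype also has elements that are no points, such as
  parameters outside the open unit interval; \<open>qpoints\<close> plays the same role for
  \<open>D/P\<close>.\<close>

definition points :: "'v dpoint set" where
  "points = DNode ` nodes \<union> {DInner e t | e t. e \<in> all_edges V E \<and> 0 < t \<and> t < 1}"

definition qpoints :: "'v set set \<Rightarrow> 'v qpoint set" where
  "qpoints P = QV ` P \<union> {QI q t | q t. q \<in> qedges V E P \<and> 0 < t \<and> t < 1}"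

lemma qedges_ends:
  assumes "is_partition V P" "q \<in> qedges V E P"
  shows "qtail P q \<in> P" "qhead P q \<in> P" "qtail P q \<noteq> qhead P q"
  using assms(2) cls_in[OF assms(1)] edge_in
  unfolding qedges_def qtail_def qhead_def by auto

lemma topspace_QTop:
  shows "topspace (QTop V E P) = qpoints P"
proof
  show "topspace (QTop V E P) \<subseteq> qpoints P"
    unfolding QTop_def topology_generated_by_topspace qpoints_def
    by (auto simp: qstar_def qint_def)
next
  have 1: "QV p \<in> topspace (QTop V E P)" if "p \<in> P" for p
    unfolding QTop_def topology_generated_by_topspace
  proof (rule UnionI)
    show "qstar V E P p (1/2) \<in> {qstar V E P p \<epsilon> | p \<epsilon>. p \<in> P \<and> 0 < \<epsilon> \<and> \<epsilon> < 1}
      \<union> {qint e a b | e a b. e \<in> qedges V E P \<and> 0 \<le> a \<and> a < b \<and> b \<le> 1}"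
      using that by (intro UnI1 CollectI exI[of _ p] exI[of _ "1/2"]) auto
  qed (simp add: qstar_def)
  have 2: "QI q t \<in> topspace (QTop V E P)" if "q \<in> qedges V E P" "0 < t" "t < 1" for q t
    unfolding QTop_def topology_generated_by_topspace
  proof (rule UnionI)
    show "qint q 0 1 \<in> {qstar V E P p \<epsilon> | p \<epsilon>. p \<in> P \<and> 0 < \<epsilon> \<and> \<epsilon> < 1}
      \<union> {qint e a b | e a b. e \<in> qedges V E P \<and> 0 \<le> a \<and> a < b \<and> b \<le> 1}"
      using that by (intro UnI2 CollectI exI[of _ q] exI[of _ 0] exI[of _ 1]) auto
  qed (use that in \<open>simp add: qint_def\<close>)
  show "qpoints P \<subseteq> topspace (QTop V E P)"
    using 1 2 unfolding qpoints_def by auto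
qed

lemma openin_qstar:
  assumes "p \<in> P" "0 < \<epsilon>" "\<epsilon> < 1"
  shows "openin (QTop V E P) (qstar V E P p \<epsilon>)"
  unfolding QTop_def by (rule topology_generated_by_Basis) (use assms in blast)

lemma openin_qint:
  assumes "q \<in> qedges V E P" "0 \<le> a" "a < b" "b \<le> 1"
  shows "openin (QTop V E P) (qint q a b)"
  unfolding QTop_def by (rule topology_generated_by_Basis) (use assms in blast)

text \<open>If there is no quotient edge then \<open>e\<close> is an edge of \<open>D\<close>, so that \<open>projl\<close> is applied to vertices only.\<close>

definition qimg :: "'v set set \<Rightarrow> 'v node \<times> 'v node \<Rightarrow> 'v qedge" where
  "qimg P e = (if QQ (nimg P (fst e)) (nimg P (snd e)) \<in> qedges V E P
     then QQ (nimg P (fst e)) (nimg P (snd e)) else QE (projl (fst e), projl (snd e)))"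

lemma all_edges_cases:
  assumes "(n, m) \<in> all_edges V E"
  obtains u w where "n = Inl u" "m = Inl w" "(u, w) \<in> E" | "(n, m) \<in> limit_edges V E"
  using assms unfolding all_edges_def by auto

lemma QQ_in_qedges:
  assumes "P \<in> adm_parts V E" "n \<in> nodes" "m \<in> nodes" "nimg P n \<noteq> nimg P m"
  shows "QQ (nimg P n) (nimg P m) \<in> qedges V E P \<longleftrightarrow> infinite (edges_between E (nimg P n) (nimg P m))"
  using nimg_in[OF assms(1)] assms(2-4) unfolding qedges_def by auto

lemma phi_DNode: "phi V E P (DNode n) = QV (nimg P n)"
  unfolding phi_def by simp

text \<open>The \<open>undefined\<close> branch of \<open>phi\<close> is never reached: a limit edge
  whose endpoints have different classes has a quotient edge to map to.\<close>

lemma phi_DInner: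
  assumes "P \<in> adm_parts V E" "(n, m) \<in> all_edges V E"
  shows "phi V E P (DInner (n, m) t) =
    (if nimg P n = nimg P m then QV (nimg P n) else QI (qimg P (n, m)) t)"
  using assms(2)
proof (cases rule: all_edges_cases)
  case (1 u w)
  then show ?thesis unfolding phi_def qimg_def Let_def by simp
next
  case 2
  then show ?thesis
    using limit_edge_infinite[OF _ assms(1)] QQ_in_qedges[OF assms(1)] all_edges_nodes[OF assms(2)]
    unfolding phi_def qimg_def Let_def by simp
qed

lemma qimg_spec:
  assumes "P \<in> adm_parts V E" "(n, m) \<in> all_edges V E" "nimg P n \<noteq> nimg P m"
  shows "qimg P (n, m) \<in> qedges V E P" "qtail P (qimg P (n, m)) = nimg P n"
    "qhead P (qimg P (n, m)) = nimg P m"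
proof -
  have "qimg P (n, m) \<in> qedges V E P \<and> qtail P (qimg P (n, m)) = nimg P n \<and>
    qhead P (qimg P (n, m)) = nimg P m"
  proof (cases "QQ (nimg P n) (nimg P m) \<in> qedges V E P")
    case True
    then show ?thesis unfolding qimg_def qtail_def qhead_def by simp
  next
    case False
    then have fin: "finite (edges_between E (nimg P n) (nimg P m))"
      using QQ_in_qedges[OF assms(1)] all_edges_nodes[OF assms(2)] assms(3) by simp
    then have "(n, m) \<notin> limit_edges V E"
      using limit_edge_infinite assms by blast
    then obtain u w where "n = Inl u" "m = Inl w" "(u, w) \<in> E"
      using all_edges_cases[OF assms(2)] by metis
    then show ?thesis
      using False fin assms(3) unfolding qimg_def qtail_def qhead_def qedges_def
      by (simp add: nimg_Inl)
  qed
  then show "qimg P (n, m) \<in> qedges V E P" "qtail P (qimg P (n, m)) = nimg P n"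
    "qhead P (qimg P (n, m)) = nimg P m" by auto
qed

lemma phi_in_qpoints:
  assumes "P \<in> adm_parts V E" "x \<in> points"
  shows "phi V E P x \<in> qpoints P"
proof (cases x)
  case (DNode n)
  then show ?thesis
    using assms nimg_in unfolding points_def qpoints_def by (auto simp: phi_DNode)
next
  case (DInner e t)
  obtain n m where e: "e = (n, m)" by force
  have *: "(n, m) \<in> all_edges V E" "0 < t" "t < 1"
    using assms(2) DInner e unfolding points_def by auto
  then show ?thesis
    using DInner e nimg_in[OF assms(1) all_edges_nodes(1)[OF *(1)]] qimg_spec[OF assms(1) *(1)]
    unfolding qpoints_def by (auto simp: phi_DInner[OF assms(1) *(1)])
qed

lemma fmap_phi:
  assumes "P \<in> adm_parts V E" "P' \<in> adm_parts V E" "refines P' P" "x \<in> points"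
  shows "fmap V E P' P (phi V E P' x) = phi V E P x"
proof (cases x)
  case (DNode n)
  then show ?thesis
    using assms super_nimg unfolding points_def fmap_def by (auto simp: phi_DNode)
next
  case (DInner e t)
  obtain n m where e: "e = (n, m)" by force
  have nm: "(n, m) \<in> all_edges V E"
    using assms(4) DInner e unfolding points_def by auto
  note nodes = all_edges_nodes[OF nm]
  have s: "super P (nimg P' n) = nimg P n" "super P (nimg P' m) = nimg P m"
    using super_nimg[OF assms(1-3)] nodes by auto
  show ?thesis
  proof (cases "nimg P n = nimg P m")
    case True
    then show ?thesis
      using s qimg_spec[OF assms(2) nm] unfolding DInner e fmap_def Let_def
      by (simp add: phi_DInner[OF assms(1) nm] phi_DInner[OF assms(2) nm])
  next
    case ne: False
    then have ne': "nimg P' n \<noteq> nimg P' m" using s by metis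
    show ?thesis
    proof (cases "QQ (nimg P n) (nimg P m) \<in> qedges V E P")
      case True
      then show ?thesis
        using s ne ne' qimg_spec[OF assms(2) nm] unfolding DInner e fmap_def Let_def
        by (simp add: phi_DInner[OF assms(1) nm] phi_DInner[OF assms(2) nm] qimg_def)
    next
      case False
      \<comment> \<open>Refining shrinks the classes, so finitely many edges stay finitely many: an
        edge surviving as a copy in \<open>D/P\<close> is the same copy in \<open>D/P'\<close>. This
        matches the last branch of \<open>fmap\<close>.\<close>
      have "edges_between E (nimg P' n) (nimg P' m) \<subseteq> edges_between E (nimg P n) (nimg P m)"
        using nimg_refines[OF assms(1-3)] nodes unfolding edges_between_def by blast
      then have "finite (edges_between E (nimg P' n) (nimg P' m))"
        using False QQ_in_qedges[OF assms(1) nodes(1,2) ne] finite_subset by blast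
      then have "QQ (nimg P' n) (nimg P' m) \<notin> qedges V E P'"
        using QQ_in_qedges[OF assms(2) nodes(1,2) ne'] by simp
      then show ?thesis
        using s ne ne' False qimg_spec[OF assms(2) nm] unfolding DInner e fmap_def Let_def
        by (simp add: phi_DInner[OF assms(1) nm] phi_DInner[OF assms(2) nm] qimg_def)
    qed
  qed
qed

text \<open>Used contrapositively: nodes once separated stay separated when the finite set
  grows.\<close>

lemma nimg_parts_mono:
  assumes "X \<subseteq> X'" "X' \<in> fin_sets V" "n \<in> nodes" "m \<in> nodes"
    "nimg (parts X') n = nimg (parts X') m"
  shows "nimg (parts X) n = nimg (parts X) m"
proof -
  have "X \<in> fin_sets V" using assms(1,2) finite_subset unfolding fin_sets_def by auto
  then show ?thesis
    using super_nimg[OF parts_adm parts_adm parts_mono, of X X'] assms by metis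
qed

text \<open>The union of separating sets over the finitely many pairs works, because separation
  persists under enlargement.\<close>

lemma separate_finite:
  assumes "finite S" "S \<subseteq> nodes"
  obtains X where "X \<in> fin_sets V" "inj_on (nimg (parts X)) S"
proof -
  \<comment> \<open>The implication makes the choice meaningful on the diagonal too, where the empty
    set is a witness.\<close>
  define X where "X n m = (SOME X. X \<in> fin_sets V \<and>
    (n \<noteq> m \<longrightarrow> nimg (parts X) n \<noteq> nimg (parts X) m))" for n m
  have X: "X n m \<in> fin_sets V \<and> (n \<noteq> m \<longrightarrow> nimg (parts (X n m)) n \<noteq> nimg (parts (X n m)) m)"
    if "n \<in> S" "m \<in> S" for n m
  proof -
    have nm: "n \<in> nodes" "m \<in> nodes" using that assms(2) by auto
    have "\<exists>X. X \<in> fin_sets V \<and> (n \<noteq> m \<longrightarrow> nimg (parts X) n \<noteq> nimg (parts X) m)"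
    proof (cases "n = m")
      case True
      moreover have "{} \<in> fin_sets V" unfolding fin_sets_def by simp
      ultimately show ?thesis by blast
    next
      case False
      then show ?thesis using separate_nodes[OF nm] by metis
    qed
    then show ?thesis unfolding X_def by (rule someI_ex)
  qed
  define Z where "Z = (\<Union>n\<in>S. \<Union>m\<in>S. X n m)"
  have Z: "Z \<in> fin_sets V"
    using X assms(1) unfolding Z_def fin_sets_def by auto
  have "inj_on (nimg (parts Z)) S"
  proof (rule inj_onI)
    fix n m assume nm: "n \<in> S" "m \<in> S" "nimg (parts Z) n = nimg (parts Z) m"
    then have "X n m \<subseteq> Z" unfolding Z_def by auto
    then have "nimg (parts (X n m)) n = nimg (parts (X n m)) m"
      by (rule nimg_parts_mono[OF _ Z]) (use nm assms(2) in blast)+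
    then show "n = m" using X[OF nm(1,2)] by simp
  qed
  then show thesis using that Z by blast
qed

fun pnodes :: "'v dpoint \<Rightarrow> 'v node set" where
  "pnodes (DNode n) = {n}"
| "pnodes (DInner e t) = {fst e, snd e}"

lemma pnodes: "x \<in> points \<Longrightarrow> finite (pnodes x) \<and> pnodes x \<subseteq> nodes"
  using all_edges_nodes unfolding points_def by auto

text \<open>A single quotient distinguishes \<open>x\<close> from \<open>y\<close>: take
  \<open>X\<close> separating the at most four nodes involved. Then no inner point is collapsed, and
  tail and head of the image edge recover the endpoints of the original edge.\<close>

lemma phi_inj:
  assumes "x \<in> points" "y \<in> points" "\<And>P. P \<in> adm_parts V E \<Longrightarrow> phi V E P x = phi V E P y"
  shows "x = y"
proof -
  obtain X where X: "X \<in> fin_sets V" "inj_on (nimg (parts X)) (pnodes x \<union> pnodes y)"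
    using separate_finite[of "pnodes x \<union> pnodes y"] pnodes assms(1,2) by blast
  define P where "P = parts X"
  have P: "P \<in> adm_parts V E" using parts_adm[OF X(1)] unfolding P_def .
  have inj: "n = m" if "nimg P n = nimg P m" "n \<in> pnodes x \<union> pnodes y" "m \<in> pnodes x \<union> pnodes y" for n m
    using X(2) that unfolding P_def inj_on_def by blast
  have inner: "phi V E P (DInner (n, m) t) = QI (qimg P (n, m)) t \<and>
      qtail P (qimg P (n, m)) = nimg P n \<and> qhead P (qimg P (n, m)) = nimg P m"
    if "DInner (n, m) t \<in> points" "{n, m} \<subseteq> pnodes x \<union> pnodes y" for n m t
  proof -
    have nm: "(n, m) \<in> all_edges V E" using that(1) unfolding points_def by auto
    have "nimg P n \<noteq> nimg P m" using inj[of n m] that(2) all_edges_nodes(3)[OF nm] by auto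
    then show ?thesis using phi_DInner[OF P nm] qimg_spec[OF P nm] by simp
  qed
  note eq = assms(3)[OF P]
  show ?thesis
  proof (cases x)
    case x: (DNode n)
    show ?thesis
    proof (cases y)
      case (DNode m)
      then show ?thesis using eq inj[of n m] x by (simp add: phi_DNode)
    next
      case (DInner e t)
      then show ?thesis
        using eq inner[of "fst e" "snd e" t] x assms(2) by (simp add: phi_DNode)
    qed
  next
    case x: (DInner e t)
    note ix = inner[of "fst e" "snd e" t]
    show ?thesis
    proof (cases y)
      case (DNode m)
      then show ?thesis using eq ix x assms(1) by (simp add: phi_DNode)
    next
      case (DInner e' t')
      note iy = inner[of "fst e'" "snd e'" t']
      have i: "phi V E P x = QI (qimg P e) t" "qtail P (qimg P e) = nimg P (fst e)"
        "qhead P (qimg P e) = nimg P (snd e)" using ix x assms(1) by auto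
      have j: "phi V E P y = QI (qimg P e') t'" "qtail P (qimg P e') = nimg P (fst e')"
        "qhead P (qimg P e') = nimg P (snd e')" using iy DInner assms(2) by auto
      have q: "qimg P e = qimg P e'" "t = t'" using eq i(1) j(1) by auto
      have "nimg P (fst e) = nimg P (fst e')" "nimg P (snd e) = nimg P (snd e')"
        using i(2,3) j(2,3) q(1) by metis+
      then have "fst e = fst e'" "snd e = snd e'" by (auto intro: inj simp: x DInner)
      then show ?thesis using x DInner q by (simp add: prod_eq_iff)
    qed
  qed
qed

end

section \<open>Basic open sets as preimages\<close>

context solid_digraph
begin

section \<open>Preimages under the quotient maps\<close>

definition preim :: "'v set set \<Rightarrow> 'v qpoint set \<Rightarrow> 'v dpoint set" where
  "preim P U = {x \<in> points. phi V E P x \<in> U}"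

lemma DNode_preim: "DNode n \<in> preim P U \<longleftrightarrow> n \<in> nodes \<and> QV (nimg P n) \<in> U"
  unfolding preim_def points_def by (auto simp: phi_DNode)

lemma DInner_points: "DInner e t \<in> points \<longleftrightarrow> e \<in> all_edges V E \<and> 0 < t \<and> t < 1"
  unfolding points_def by (cases e) auto

lemma DInner_preim:
  assumes "P \<in> adm_parts V E"
  shows "DInner e t \<in> preim P U \<longleftrightarrow> e \<in> all_edges V E \<and> 0 < t \<and> t < 1 \<and>
    (if nimg P (fst e) = nimg P (snd e) then QV (nimg P (fst e)) \<in> U else QI (qimg P e) t \<in> U)"
  using phi_DInner[OF assms, of "fst e" "snd e" t] unfolding preim_def
  by (cases "nimg P (fst e) = nimg P (snd e)") (auto simp: DInner_points)

text \<open>The three alternatives mirror \<open>endnbhd\<close>: edges collapsed to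
  \<open>p\<close> belong entirely to the preimage, edges with exactly one end over \<open>p\<close>
  contribute a segment of length \<epsilon>.\<close>

lemma DInner_preim_qstar:
  assumes "P \<in> adm_parts V E"
  shows "DInner e t \<in> preim P (qstar V E P p \<epsilon>) \<longleftrightarrow> e \<in> all_edges V E \<and> 0 < t \<and> t < 1 \<and>
    (nimg P (fst e) = p \<and> nimg P (snd e) = p \<or>
     nimg P (fst e) = p \<and> nimg P (snd e) \<noteq> p \<and> t < \<epsilon> \<or>
     nimg P (fst e) \<noteq> p \<and> nimg P (snd e) = p \<and> 1 - \<epsilon> < t)"
  using qimg_spec[OF assms, of "fst e" "snd e"]
  unfolding DInner_preim[OF assms] by (auto simp: qstar_def)

lemma all_edges_fst: "e \<in> all_edges V E \<Longrightarrow> fst e \<in> nodes"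
  and all_edges_snd: "e \<in> all_edges V E \<Longrightarrow> snd e \<in> nodes"
  and all_edges_neq: "e \<in> all_edges V E \<Longrightarrow> fst e \<noteq> snd e"
  using all_edges_nodes by (metis prod.collapse)+

lemma endnbhd_eq_preim:
  assumes "\<omega> \<in> ends V E" "X \<in> fin_sets V" "0 < \<epsilon>" "\<epsilon> < 1"
  shows "endnbhd V E X \<omega> \<epsilon> = preim (parts X) (qstar V E (parts X) (comp V E X \<omega>) \<epsilon>)"
    (is "?L = ?R")
proof (rule set_eqI)
  fix x
  note L = lives_in_iff[OF assms(2) comp_spec(1)[OF assms(1,2)]]
  show "x \<in> ?L \<longleftrightarrow> x \<in> ?R"
  proof (cases x)
    case (DNode n)
    then show ?thesis
      unfolding endnbhd_def Let_def by (auto simp: DNode_preim L qstar_def)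
  next
    case (DInner e t)
    have "x \<in> ?L \<longleftrightarrow> e \<in> all_edges V E \<and> 0 < t \<and> t < 1 \<and>
      (lives_in V E X (comp V E X \<omega>) (fst e) \<and> lives_in V E X (comp V E X \<omega>) (snd e) \<or>
       lives_in V E X (comp V E X \<omega>) (fst e) \<and> \<not> lives_in V E X (comp V E X \<omega>) (snd e) \<and> t < \<epsilon> \<or>
       \<not> lives_in V E X (comp V E X \<omega>) (fst e) \<and> lives_in V E X (comp V E X \<omega>) (snd e) \<and> 1 - \<epsilon> < t)"
      unfolding endnbhd_def Let_def DInner using assms(3,4) by (cases e) auto
    then show ?thesis
      unfolding DInner DInner_preim_qstar[OF parts_adm[OF assms(2)]] L
      using all_edges_fst all_edges_snd by blast
  qed
qed

text \<open>With \<open>X = {v}\<close> the class of \<open>v\<close> is a singleton containing no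
  other node, and since edges have distinct endpoints none is collapsed to it.\<close>

lemma vstar_eq_preim:
  assumes "v \<in> V" "0 < \<epsilon>" "\<epsilon> < 1"
  shows "vstar V E v \<epsilon> = preim (parts {v}) (qstar V E (parts {v}) {v} \<epsilon>)"
    (is "?L = ?R")
proof (rule set_eqI)
  fix x
  have X: "{v} \<in> fin_sets V" using assms(1) unfolding fin_sets_def by auto
  have v: "Inl v \<in> nodes" using assms(1) unfolding nodes_def by auto
  note N = nimg_parts_vertex[OF X singletonI]
  show "x \<in> ?L \<longleftrightarrow> x \<in> ?R"
  proof (cases x)
    case (DNode n)
    have "x \<in> ?L \<longleftrightarrow> n = Inl v" unfolding vstar_def DNode by auto
    then show ?thesis
      unfolding DNode DNode_preim using N[of n] v by (auto simp: qstar_def)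
  next
    case (DInner e t)
    have "x \<in> ?L \<longleftrightarrow> e \<in> all_edges V E \<and> 0 < t \<and> t < 1 \<and>
      (fst e = Inl v \<and> t < \<epsilon> \<or> snd e = Inl v \<and> 1 - \<epsilon> < t)"
      unfolding vstar_def DInner using assms(2,3) by (cases e) auto
    then show ?thesis
      unfolding DInner DInner_preim_qstar[OF parts_adm[OF X]]
      using N all_edges_fst all_edges_snd all_edges_neq by metis
  qed
qed

text \<open>With both endpoints in \<open>X\<close> their classes are singletons. Between these runs
  just one edge, so it survives as its own copy, and no other edge of |D| maps onto that
  copy.\<close>

lemma eint_eq_preim:
  assumes "(u, w) \<in> E" "0 \<le> a" "b \<le> 1"
  shows "QE (u, w) \<in> qedges V E (parts {u, w})"
    and "eint (u, w) a b = preim (parts {u, w}) (qint (QE (u, w)) a b)" (is "?L = ?R")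
proof -
  have uw: "u \<in> V" "w \<in> V" "u \<noteq> w" using edge_in[OF assms(1)] by auto
  have X: "{u, w} \<in> fin_sets V" using uw unfolding fin_sets_def by auto
  note P = parts_adm[OF X]
  have "Inl u \<in> nodes" "Inl w \<in> nodes" using uw unfolding nodes_def by auto
  then have N: "cls (parts {u, w}) u = {u}" "cls (parts {u, w}) w = {w}"
    using nimg_parts_vertex[OF X] nimg_Inl by (metis insertCI)+
  have "edges_between E {u} {w} \<subseteq> {(u, w)}" unfolding edges_between_def by auto
  then have fin: "finite (edges_between E {u} {w})" using finite_subset by blast
  then show QE: "QE (u, w) \<in> qedges V E (parts {u, w})"
    using assms(1) uw N unfolding qedges_def by simp
  show "?L = ?R"
  proof (rule set_eqI)
    fix x
    show "x \<in> ?L \<longleftrightarrow> x \<in> ?R"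
    proof (cases x)
      case (DNode n)
      then show ?thesis unfolding eint_def qint_def DNode DNode_preim by simp
    next
      case (DInner e t)
      have "qimg (parts {u, w}) e = QE (u, w) \<and> nimg (parts {u, w}) (fst e) \<noteq> nimg (parts {u, w}) (snd e)
         \<longleftrightarrow> e = (Inl u, Inl w)" if e: "e \<in> all_edges V E"
      proof
        assume a: "qimg (parts {u, w}) e = QE (u, w) \<and> nimg (parts {u, w}) (fst e) \<noteq> nimg (parts {u, w}) (snd e)"
        then have "nimg (parts {u, w}) (fst e) = {u}" "nimg (parts {u, w}) (snd e) = {w}"
          using qimg_spec(2,3)[OF P, of "fst e" "snd e"] e N unfolding qtail_def qhead_def by auto
        then have "fst e = Inl u" "snd e = Inl w"
          using nimg_parts_vertex[OF X] all_edges_fst[OF e] all_edges_snd[OF e] by auto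
        then show "e = (Inl u, Inl w)" by (simp add: prod_eq_iff)
      next
        assume "e = (Inl u, Inl w)"
        then show "qimg (parts {u, w}) e = QE (u, w) \<and> nimg (parts {u, w}) (fst e) \<noteq> nimg (parts {u, w}) (snd e)"
          using N uw fin unfolding qimg_def qedges_def by (auto simp: nimg_Inl)
      qed
      moreover have "(Inl u, Inl w) \<in> all_edges V E" using assms(1) unfolding all_edges_def by auto
      ultimately show ?thesis
        unfolding DInner DInner_preim[OF P] using assms(2,3) by (auto simp: eint_def qint_def)
    qed
  qed
qed

lemma limit_edges_sub: "l \<in> limit_edges V E \<Longrightarrow> l \<in> all_edges V E"
  unfolding all_edges_def by auto

lemma limit_edges_types:
  assumes "l \<in> limit_edges V E"
  obtains \<omega> \<eta> where "l = (Inr \<omega>, Inr \<eta>)" "\<omega> \<in> ends V E" "\<eta> \<in> ends V E"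
  | v \<omega> where "l = (Inl v, Inr \<omega>)" "v \<in> V" "\<omega> \<in> ends V E"
  | v \<omega> where "l = (Inr \<omega>, Inl v)" "v \<in> V" "\<omega> \<in> ends V E"
  using assms unfolding limit_edges_def by blast

lemma epred_Inl:
  assumes "X \<in> fin_sets V" "v \<in> X" "k \<in> nodes"
  shows "epred V E X (Inl v) k \<longleftrightarrow> nimg (parts X) k = nimg (parts X) (Inl v)"
proof -
  have "Inl v \<in> nodes" using assms unfolding nodes_def fin_sets_def by auto
  then show ?thesis
    using nimg_parts_vertex[OF assms(1,2), of "Inl v"] nimg_parts_vertex[OF assms(1,2,3)]
    unfolding epred_def by simp
qed

lemma epred_Inr:
  assumes "X \<in> fin_sets V" "\<omega> \<in> ends V E" "k \<in> nodes"
  shows "epred V E X (Inr \<omega>) k \<longleftrightarrow> nimg (parts X) k = nimg (parts X) (Inr \<omega>)"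
  using lives_in_iff[OF assms(1) comp_spec(1)[OF assms(2,1)]] nimg_parts_end[OF assms(1,2)] assms(3)
  unfolding epred_def by simp

text \<open>Under \<open>lim_adm\<close> a vertex endpoint lies in \<open>X\<close> and so has a
  singleton class, while two end endpoints live in different components. Hence \<open>epred\<close>
  just compares classes, and the edge is not collapsed.\<close>

lemma lim_adm_spec:
  assumes "l \<in> limit_edges V E" "X \<in> fin_sets V" "lim_adm V E X l"
  shows "\<And>k. k \<in> nodes \<Longrightarrow> epred V E X (fst l) k \<longleftrightarrow> nimg (parts X) k = nimg (parts X) (fst l)"
    "\<And>k. k \<in> nodes \<Longrightarrow> epred V E X (snd l) k \<longleftrightarrow> nimg (parts X) k = nimg (parts X) (snd l)"
    "nimg (parts X) (fst l) \<noteq> nimg (parts X) (snd l)"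
proof -
  have "(\<forall>k\<in>nodes. epred V E X (fst l) k \<longleftrightarrow> nimg (parts X) k = nimg (parts X) (fst l)) \<and>
    (\<forall>k\<in>nodes. epred V E X (snd l) k \<longleftrightarrow> nimg (parts X) k = nimg (parts X) (snd l)) \<and>
    nimg (parts X) (fst l) \<noteq> nimg (parts X) (snd l)"
    using assms(1)
  proof (cases rule: limit_edges_types)
    case (1 \<omega> \<eta>)
    then show ?thesis
      using assms(3) epred_Inr[OF assms(2)] nimg_parts_end[OF assms(2)] unfolding lim_adm_def by simp
  next
    case (2 v \<omega>)
    then have v: "v \<in> X" "Inl v \<in> nodes" "Inr \<omega> \<in> nodes"
      using assms(3) unfolding lim_adm_def nodes_def by auto
    have "nimg (parts X) (Inl v) \<noteq> nimg (parts X) (Inr \<omega>)"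
      using nimg_parts_vertex[OF assms(2) v(1)] v(2,3) by (metis Inl_Inr_False)
    then show ?thesis
      using 2 epred_Inr[OF assms(2)] epred_Inl[OF assms(2) v(1)] by simp
  next
    case (3 v \<omega>)
    then have v: "v \<in> X" "Inl v \<in> nodes" "Inr \<omega> \<in> nodes"
      using assms(3) unfolding lim_adm_def nodes_def by auto
    have "nimg (parts X) (Inl v) \<noteq> nimg (parts X) (Inr \<omega>)"
      using nimg_parts_vertex[OF assms(2) v(1)] v(2,3) by (metis Inl_Inr_False)
    then show ?thesis
      using 3 epred_Inr[OF assms(2)] epred_Inl[OF assms(2) v(1)] by simp
  qed
  then show "\<And>k. k \<in> nodes \<Longrightarrow> epred V E X (fst l) k \<longleftrightarrow> nimg (parts X) k = nimg (parts X) (fst l)"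
    "\<And>k. k \<in> nodes \<Longrightarrow> epred V E X (snd l) k \<longleftrightarrow> nimg (parts X) k = nimg (parts X) (snd l)"
    "nimg (parts X) (fst l) \<noteq> nimg (parts X) (snd l)" by blast+
qed

text \<open>Enlarge \<open>X\<close> by a set separating the two ends, or by the endpoint that is a
  vertex.\<close>

lemma lim_adm_ex:
  assumes "l \<in> limit_edges V E" "X \<in> fin_sets V"
  obtains X' where "X' \<in> fin_sets V" "X \<subseteq> X'" "lim_adm V E X' l"
  using assms(1)
proof (cases rule: limit_edges_types)
  case (1 \<omega> \<eta>)
  have nodes: "Inr \<omega> \<in> nodes" "Inr \<eta> \<in> nodes" "Inr \<omega> \<noteq> (Inr \<eta> :: 'v node)"
    using all_edges_nodes[OF limit_edges_sub[OF assms(1)[unfolded 1(1)]]] by auto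
  then obtain Y where Y: "Y \<in> fin_sets V" "nimg (parts Y) (Inr \<omega>) \<noteq> nimg (parts Y) (Inr \<eta>)"
    using separate_nodes by blast
  have XY: "X \<union> Y \<in> fin_sets V" by (rule fin_sets_Un[OF assms(2) Y(1)])
  have "nimg (parts (X \<union> Y)) (Inr \<omega>) \<noteq> nimg (parts (X \<union> Y)) (Inr \<eta>)"
    using nimg_parts_mono[OF _ XY nodes(1,2)] Y(2) by blast
  then show thesis
    using that[OF XY] 1 nimg_parts_end[OF XY] unfolding lim_adm_def by simp
next
  case (2 v \<omega>)
  then have "X \<union> {v} \<in> fin_sets V" using assms(2) unfolding fin_sets_def by auto
  from that[OF this] show thesis using 2 unfolding lim_adm_def by auto
next
  case (3 v \<omega>)
  then have "X \<union> {v} \<in> fin_sets V" using assms(2) unfolding fin_sets_def by auto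
  from that[OF this] show thesis using 3 unfolding lim_adm_def by auto
qed

lemma limnbhd_eq:
  assumes "l \<in> limit_edges V E" "X \<in> fin_sets V" "lim_adm V E X l"
  shows "limnbhd V E l t0 X \<epsilon> = {DInner e t | e t. e \<in> all_edges V E \<and>
    nimg (parts X) (fst e) = nimg (parts X) (fst l) \<and> nimg (parts X) (snd e) = nimg (parts X) (snd l) \<and>
    0 < t \<and> t < 1 \<and> \<bar>t - t0\<bar> < \<epsilon>}"
  unfolding limnbhd_def using lim_adm_spec(1,2)[OF assms] all_edges_fst all_edges_snd by blast

lemma limit_edge_QQ:
  assumes "l \<in> limit_edges V E" "P \<in> adm_parts V E" "nimg P (fst l) \<noteq> nimg P (snd l)"
  shows "QQ (nimg P (fst l)) (nimg P (snd l)) \<in> qedges V E P"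
  using limit_edge_infinite[of "fst l" "snd l"] assms all_edges_nodes[of "fst l" "snd l"]
    limit_edges_sub[OF assms(1)] QQ_in_qedges[OF assms(2)] by simp

text \<open>All edges in the neighbourhood lie over one quotient edge, with parameters preserved.
  The bounds are clipped by \<open>max\<close> and \<open>min\<close> because basic intervals of
  \<open>QTop\<close> lie within the unit interval, whereas \<epsilon> may be arbitrarily large
  here.\<close>

lemma limnbhd_eq_preim:
  assumes "l \<in> limit_edges V E" "X \<in> fin_sets V" "lim_adm V E X l"
  shows "limnbhd V E l t0 X \<epsilon> = preim (parts X)
    (qint (QQ (nimg (parts X) (fst l)) (nimg (parts X) (snd l))) (max 0 (t0 - \<epsilon>)) (min 1 (t0 + \<epsilon>)))"
    (is "?L = ?R")
proof (rule set_eqI)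
  fix x
  note P = parts_adm[OF assms(2)]
  note ne = lim_adm_spec(3)[OF assms]
  note QQ = limit_edge_QQ[OF assms(1) P ne]
  show "x \<in> ?L \<longleftrightarrow> x \<in> ?R"
  proof (cases x)
    case (DNode n)
    then show ?thesis unfolding limnbhd_def qint_def DNode DNode_preim by simp
  next
    case (DInner e t)
    have "qimg (parts X) e = QQ (nimg (parts X) (fst l)) (nimg (parts X) (snd l)) \<longleftrightarrow>
      nimg (parts X) (fst e) = nimg (parts X) (fst l) \<and> nimg (parts X) (snd e) = nimg (parts X) (snd l)"
      using QQ unfolding qimg_def by auto
    moreover have "x \<in> ?R \<longleftrightarrow> e \<in> all_edges V E \<and> 0 < t \<and> t < 1 \<and>
      nimg (parts X) (fst e) \<noteq> nimg (parts X) (snd e) \<and>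
      qimg (parts X) e = QQ (nimg (parts X) (fst l)) (nimg (parts X) (snd l)) \<and> \<bar>t - t0\<bar> < \<epsilon>"
      unfolding DInner DInner_preim[OF P] qint_def by (simp add: abs_less_iff) argo
    moreover have "x \<in> ?L \<longleftrightarrow> e \<in> all_edges V E \<and> nimg (parts X) (fst e) = nimg (parts X) (fst l) \<and>
      nimg (parts X) (snd e) = nimg (parts X) (snd l) \<and> 0 < t \<and> t < 1 \<and> \<bar>t - t0\<bar> < \<epsilon>"
      unfolding DInner limnbhd_eq[OF assms] by blast
    ultimately show ?thesis using ne by metis
  qed
qed

text \<open>Serves both the continuity of the inverse map and the proof that the generators contain
  only elements of \<open>points\<close>.\<close>

lemma generator_preim:
  assumes "G \<in> gen_sets V E"
  obtains P U where "P \<in> adm_parts V E" "openin (QTop V E P) U" "G = preim P U"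
proof -
  have "(\<exists>v \<epsilon>. G = vstar V E v \<epsilon> \<and> v \<in> V \<and> 0 < \<epsilon> \<and> \<epsilon> < 1) \<or>
    (\<exists>e a b. G = eint e a b \<and> e \<in> E \<and> 0 \<le> a \<and> a < b \<and> b \<le> 1) \<or>
    (\<exists>X \<omega> \<epsilon>. G = endnbhd V E X \<omega> \<epsilon> \<and> \<omega> \<in> ends V E \<and> X \<in> fin_sets V \<and> 0 < \<epsilon> \<and> \<epsilon> < 1) \<or>
    (\<exists>l t0 X \<epsilon>. G = limnbhd V E l t0 X \<epsilon> \<and> l \<in> limit_edges V E \<and> 0 < t0 \<and> t0 < 1 \<and>
        X \<in> fin_sets V \<and> lim_adm V E X l \<and> 0 < \<epsilon>)"
    using assms unfolding gen_sets_def by blast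
  then show thesis
  proof (elim disjE exE conjE)
    fix v \<epsilon> assume *: "G = vstar V E v \<epsilon>" "v \<in> V" "0 < \<epsilon>" "\<epsilon> < (1::real)"
    then have X: "{v} \<in> fin_sets V" unfolding fin_sets_def by auto
    have "{v} \<in> parts {v}" unfolding parts_def by simp
    then show thesis
      using that[OF parts_adm[OF X] openin_qstar] vstar_eq_preim * by metis
  next
    fix e and a b :: real assume *: "G = eint e a b" "e \<in> E" "0 \<le> a" "a < b" "b \<le> 1"
    obtain u w where e: "e = (u, w)" by force
    then have X: "{u, w} \<in> fin_sets V" using edge_in * unfolding fin_sets_def by auto
    show thesis
      using that[OF parts_adm[OF X] openin_qint] eint_eq_preim * e by metis
  next
    fix X \<omega> \<epsilon> assume *: "G = endnbhd V E X \<omega> \<epsilon>" "\<omega> \<in> ends V E" "X \<in> fin_sets V" "0 < \<epsilon>" "\<epsilon> < (1::real)"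
    have "comp V E X \<omega> \<in> parts X" using comp_spec[OF *(2,3)] unfolding parts_def by auto
    then show thesis
      using that[OF parts_adm[OF *(3)] openin_qstar] endnbhd_eq_preim * by metis
  next
    fix l t0 X \<epsilon> assume *: "G = limnbhd V E l t0 X \<epsilon>" "l \<in> limit_edges V E" "0 < t0" "t0 < 1"
      "X \<in> fin_sets V" "lim_adm V E X l" "0 < (\<epsilon> :: real)"
    have QQ: "QQ (nimg (parts X) (fst l)) (nimg (parts X) (snd l)) \<in> qedges V E (parts X)"
      using limit_edge_QQ[OF *(2) parts_adm[OF *(5)]] lim_adm_spec(3)[OF *(2,5,6)] .
    show thesis
      by (rule that[OF parts_adm[OF *(5)] openin_qint[OF QQ, of "max 0 (t0 - \<epsilon>)" "min 1 (t0 + \<epsilon>)"]])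
        (use * in \<open>auto simp: limnbhd_eq_preim\<close>)
  qed
qed

section \<open>Continuity of the quotient maps\<close>

definition locally_open :: "'v set set \<Rightarrow> 'v qpoint set \<Rightarrow> bool" where
  "locally_open P U \<longleftrightarrow>
    (\<forall>p\<in>P. QV p \<in> U \<longrightarrow> (\<exists>\<epsilon>. 0 < \<epsilon> \<and> \<epsilon> < 1 \<and> qstar V E P p \<epsilon> \<subseteq> U)) \<and>
    (\<forall>q\<in>qedges V E P. \<forall>t. QI q t \<in> U \<and> 0 < t \<and> t < 1 \<longrightarrow>
       (\<exists>\<delta>>0. \<forall>s. 0 < s \<and> s < 1 \<and> \<bar>s - t\<bar> < \<delta> \<longrightarrow> QI q s \<in> U))"

lemma locally_open_qstar:
  assumes "0 < \<epsilon>" "\<epsilon> < 1"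
  shows "locally_open P (qstar V E P p \<epsilon>)"
  unfolding locally_open_def
proof (intro conjI ballI allI impI)
  fix p' assume "QV p' \<in> qstar V E P p \<epsilon>"
  then have "p' = p" unfolding qstar_def by auto
  then show "\<exists>\<epsilon>'>0. \<epsilon>' < 1 \<and> qstar V E P p' \<epsilon>' \<subseteq> qstar V E P p \<epsilon>"
    using assms by auto
next
  fix q t assume q: "q \<in> qedges V E P" "QI q t \<in> qstar V E P p \<epsilon> \<and> 0 < t \<and> t < 1"
  then consider "qtail P q = p" "t < \<epsilon>" | "qhead P q = p" "1 - \<epsilon> < t" unfolding qstar_def by auto
  then show "\<exists>\<delta>>0. \<forall>s. 0 < s \<and> s < 1 \<and> \<bar>s - t\<bar> < \<delta> \<longrightarrow> QI q s \<in> qstar V E P p \<epsilon>"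
  proof cases
    case 1
    then show ?thesis using q by (intro exI[of _ "\<epsilon> - t"]) (auto simp: qstar_def)
  next
    case 2
    then show ?thesis using q by (intro exI[of _ "t - (1 - \<epsilon>)"]) (auto simp: qstar_def)
  qed
qed

lemma locally_open_qint: "locally_open P (qint q a b)"
  unfolding locally_open_def
proof (intro conjI ballI allI impI)
  fix q' t assume "QI q' t \<in> qint q a b \<and> 0 < t \<and> t < 1"
  then have "q' = q" "a < t" "t < b" unfolding qint_def by auto
  then show "\<exists>\<delta>>0. \<forall>s. 0 < s \<and> s < 1 \<and> \<bar>s - t\<bar> < \<delta> \<longrightarrow> QI q' s \<in> qint q a b"
    by (intro exI[of _ "min (t - a) (b - t)"]) (auto simp: qint_def)
qed (auto simp: qint_def)

lemma locally_open_qpoints: "locally_open P (qpoints P)"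
  unfolding locally_open_def
proof (intro conjI ballI allI impI)
  fix p assume "p \<in> P"
  then show "\<exists>\<epsilon>>0. \<epsilon> < 1 \<and> qstar V E P p \<epsilon> \<subseteq> qpoints P"
    by (intro exI[of _ "1/2"]) (auto simp: qstar_def qpoints_def)
next
  fix q t assume "q \<in> qedges V E P"
  then show "\<exists>\<delta>>0. \<forall>s. 0 < s \<and> s < 1 \<and> \<bar>s - t\<bar> < \<delta> \<longrightarrow> QI q s \<in> qpoints P"
    by (intro exI[of _ 1]) (auto simp: qpoints_def)
qed

lemma preim_mono: "U \<subseteq> U' \<Longrightarrow> preim P U \<subseteq> preim P U'"
  unfolding preim_def by auto

text \<open>The same \<epsilon> works upstairs: an edge at \<open>v\<close> is either collapsed into
  the class of \<open>v\<close> or mapped with its parameter onto an edge at that class.\<close>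

lemma preim_nbhd_vertex:
  assumes P: "P \<in> adm_parts V E" and U: "locally_open P U" and x: "DNode (Inl v) \<in> preim P U"
  shows "\<exists>G\<in>gen_sets V E. DNode (Inl v) \<in> G \<and> G \<subseteq> preim P U"
proof -
  have v: "v \<in> V" "QV (nimg P (Inl v)) \<in> U" using x unfolding DNode_preim nodes_def by auto
  then have "nimg P (Inl v) \<in> P" using nimg_in[OF P] unfolding nodes_def by auto
  then obtain \<epsilon> where \<epsilon>: "0 < \<epsilon>" "\<epsilon> < 1" "qstar V E P (nimg P (Inl v)) \<epsilon> \<subseteq> U"
    using U v(2) unfolding locally_open_def by blast
  have "vstar V E v \<epsilon> \<subseteq> preim P (qstar V E P (nimg P (Inl v)) \<epsilon>)"
  proof
    fix y assume y: "y \<in> vstar V E v \<epsilon>"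
    show "y \<in> preim P (qstar V E P (nimg P (Inl v)) \<epsilon>)"
    proof (cases y)
      case (DNode n)
      then show ?thesis using y v unfolding vstar_def DNode DNode_preim nodes_def qstar_def by auto
    next
      case (DInner e t)
      then show ?thesis
        using y \<epsilon> unfolding vstar_def DInner DInner_preim_qstar[OF P] by auto
    qed
  qed
  moreover have "vstar V E v \<epsilon> \<in> gen_sets V E" using v \<epsilon> unfolding gen_sets_def by blast
  moreover have "DNode (Inl v) \<in> vstar V E v \<epsilon>" unfolding vstar_def by simp
  ultimately show ?thesis using preim_mono[OF \<epsilon>(3)] by blast
qed

text \<open>Choose \<open>X\<close> so that \<open>parts X\<close> refines \<open>P\<close>.
  Whatever lies over the component of \<omega> then lies over the class of \<omega> in
  \<open>P\<close>, so the star in the finer quotient maps into the star in the coarser one.\<close>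

lemma preim_nbhd_end:
  assumes P: "P \<in> adm_parts V E" and U: "locally_open P U" and x: "DNode (Inr \<omega>) \<in> preim P U"
  shows "\<exists>G\<in>gen_sets V E. DNode (Inr \<omega>) \<in> G \<and> G \<subseteq> preim P U"
proof -
  have \<omega>: "\<omega> \<in> ends V E" "QV (nimg P (Inr \<omega>)) \<in> U" "Inr \<omega> \<in> nodes"
    using x unfolding DNode_preim nodes_def by auto
  then have "nimg P (Inr \<omega>) \<in> P" using nimg_in[OF P] by auto
  then obtain \<epsilon> where \<epsilon>: "0 < \<epsilon>" "\<epsilon> < 1" "qstar V E P (nimg P (Inr \<omega>)) \<epsilon> \<subseteq> U"
    using U \<omega>(2) unfolding locally_open_def by blast
  obtain X where X: "X \<in> fin_sets V" "refines (parts X) P"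
    using parts_cofinal[OF P] by (metis subset_refl)
  note PX = parts_adm[OF X(1)]
  have coarse: "nimg P n = nimg P (Inr \<omega>)" if "nimg (parts X) n = comp V E X \<omega>" "n \<in> nodes" for n
    using super_nimg[OF P PX X(2)] that \<omega>(3) nimg_parts_end[OF X(1) \<omega>(1)] by metis
  have "endnbhd V E X \<omega> \<epsilon> \<subseteq> preim P (qstar V E P (nimg P (Inr \<omega>)) \<epsilon>)"
  proof
    fix y assume y: "y \<in> endnbhd V E X \<omega> \<epsilon>"
    then have y: "y \<in> preim (parts X) (qstar V E (parts X) (comp V E X \<omega>) \<epsilon>)"
      using endnbhd_eq_preim[OF \<omega>(1) X(1) \<epsilon>(1,2)] by simp
    show "y \<in> preim P (qstar V E P (nimg P (Inr \<omega>)) \<epsilon>)"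
    proof (cases y)
      case (DNode n)
      have "n \<in> nodes" "nimg (parts X) n = comp V E X \<omega>"
        using y unfolding DNode DNode_preim qstar_def by auto
      then show ?thesis using coarse unfolding DNode DNode_preim qstar_def by simp
    next
      case (DInner e t)
      have e: "e \<in> all_edges V E" using y unfolding DInner DInner_preim_qstar[OF PX] by simp
      show ?thesis
        using y coarse[OF _ all_edges_fst[OF e]] coarse[OF _ all_edges_snd[OF e]]
        unfolding DInner DInner_preim_qstar[OF PX] DInner_preim_qstar[OF P] by blast
    qed
  qed
  moreover have "endnbhd V E X \<omega> \<epsilon> \<in> gen_sets V E" using \<omega> X \<epsilon> unfolding gen_sets_def by blast
  moreover have "DNode (Inr \<omega>) \<in> endnbhd V E X \<omega> \<epsilon>"
    unfolding endnbhd_eq_preim[OF \<omega>(1) X(1) \<epsilon>(1,2)] DNode_preim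
    using \<omega>(3) nimg_parts_end[OF X(1) \<omega>(1)] by (simp add: qstar_def)
  ultimately show ?thesis using preim_mono[OF \<epsilon>(3)] by blast
qed

text \<open>Along a single edge the quotient map is either constant or parameter preserving.\<close>

lemma preim_inner_interval:
  assumes P: "P \<in> adm_parts V E" and U: "locally_open P U" and x: "DInner e t \<in> preim P U"
  obtains \<delta> where "0 < \<delta>" "\<And>s. 0 < s \<Longrightarrow> s < 1 \<Longrightarrow> \<bar>s - t\<bar> < \<delta> \<Longrightarrow> DInner e s \<in> preim P U"
proof (cases "nimg P (fst e) = nimg P (snd e)")
  case True
  show thesis
    by (rule that[of 1]) (use x True in \<open>auto simp: DInner_preim[OF P]\<close>)
next
  case False
  have q: "qimg P e \<in> qedges V E P"
    using qimg_spec(1)[OF P, of "fst e" "snd e"] x False by (simp add: DInner_preim[OF P])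
  have t: "QI (qimg P e) t \<in> U \<and> 0 < t \<and> t < 1" using x False by (simp add: DInner_preim[OF P])
  obtain \<delta> where \<delta>: "\<delta> > 0" "\<forall>s. 0 < s \<and> s < 1 \<and> \<bar>s - t\<bar> < \<delta> \<longrightarrow> QI (qimg P e) s \<in> U"
    using U q t unfolding locally_open_def by blast
  show thesis
    by (rule that[OF \<delta>(1)]) (use x \<delta>(2) False in \<open>auto simp: DInner_preim[OF P]\<close>)
qed

text \<open>For an edge of \<open>D\<close> an interval suffices. For a limit edge take
  \<open>X\<close> both admissible for it and large enough that \<open>parts X\<close> refines
  \<open>P\<close>: all edges in the resulting neighbourhood have the same image under
  \<open>phi\<close> as \<open>e\<close>, so the \<delta> found along \<open>e\<close> serves them
  all.\<close>

lemma preim_nbhd_inner: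
  assumes P: "P \<in> adm_parts V E" and U: "locally_open P U" and x: "DInner e t \<in> preim P U"
  shows "\<exists>G\<in>gen_sets V E. DInner e t \<in> G \<and> G \<subseteq> preim P U"
proof -
  obtain \<delta> where \<delta>: "0 < \<delta>" "\<And>s. 0 < s \<Longrightarrow> s < 1 \<Longrightarrow> \<bar>s - t\<bar> < \<delta> \<Longrightarrow> DInner e s \<in> preim P U"
    using preim_inner_interval[OF assms] by blast
  have e: "e \<in> all_edges V E" "0 < t" "t < 1" using x by (auto simp: DInner_preim[OF P])
  obtain n m where nm: "e = (n, m)" by force
  from e(1)[unfolded nm] show ?thesis
  proof (cases rule: all_edges_cases)
    case (1 u w)
    define G where "G = eint (u, w) (max 0 (t - \<delta>)) (min 1 (t + \<delta>))"
    have "G \<in> gen_sets V E"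
      using 1 e \<delta>(1) unfolding gen_sets_def G_def
      by (intro UnI1 UnI2 CollectI exI[of _ "(u, w)"] exI[of _ "max 0 (t - \<delta>)"] exI[of _ "min 1 (t + \<delta>)"]) auto
    moreover have "DInner e t \<in> G" using e \<delta>(1) 1 nm unfolding G_def eint_def by auto
    moreover have "G \<subseteq> preim P U"
      using \<delta>(2) 1 nm unfolding G_def eint_def by (auto simp: abs_less_iff)
    ultimately show ?thesis by blast
  next
    case 2
    then have l: "e \<in> limit_edges V E" using nm by simp
    obtain X0 where X0: "X0 \<in> fin_sets V" "\<And>X'. X' \<in> fin_sets V \<Longrightarrow> X0 \<subseteq> X' \<Longrightarrow> refines (parts X') P"
      using parts_cofinal[OF P] by blast
    obtain X where X: "X \<in> fin_sets V" "X0 \<subseteq> X" "lim_adm V E X e"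
      using lim_adm_ex[OF l X0(1)] by blast
    note PX = parts_adm[OF X(1)]
    have coarse: "nimg P k = nimg P k'" if "nimg (parts X) k = nimg (parts X) k'" "k \<in> nodes" "k' \<in> nodes" for k k'
      using super_nimg[OF P PX X0(2)[OF X(1,2)]] that by metis
    define G where "G = limnbhd V E e t X \<delta>"
    have "G \<in> gen_sets V E"
      using l e X \<delta>(1) unfolding gen_sets_def G_def by blast
    moreover have "DInner e t \<in> G"
      using e \<delta>(1) unfolding G_def limnbhd_eq[OF l X(1,3)] by (cases e) auto
    moreover have "G \<subseteq> preim P U"
    proof
      fix y assume "y \<in> G"
      then obtain e' s where y: "y = DInner e' s" "e' \<in> all_edges V E" "0 < s" "s < 1" "\<bar>s - t\<bar> < \<delta>"
        "nimg (parts X) (fst e') = nimg (parts X) (fst e)" "nimg (parts X) (snd e') = nimg (parts X) (snd e)"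
        unfolding G_def limnbhd_eq[OF l X(1,3)] by blast
      have img: "nimg P (fst e') = nimg P (fst e)" "nimg P (snd e') = nimg P (snd e)"
        by (rule coarse[OF y(6) all_edges_fst[OF y(2)] all_edges_fst[OF e(1)]])
          (rule coarse[OF y(7) all_edges_snd[OF y(2)] all_edges_snd[OF e(1)]])
      have "DInner e s \<in> preim P U" using \<delta>(2) y by simp
      moreover have "qimg P e' = qimg P e" if "nimg P (fst e) \<noteq> nimg P (snd e)"
        using limit_edge_QQ[OF l P that] img unfolding qimg_def by simp
      ultimately show "y \<in> preim P U"
        using y(2-4) img unfolding y(1) by (auto simp: DInner_preim[OF P] split: if_splits)
    qed
    ultimately show ?thesis by blast
  qed
qed

lemma preim_nbhd:
  assumes "P \<in> adm_parts V E" "locally_open P U" "x \<in> preim P U"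
  shows "\<exists>G\<in>gen_sets V E. x \<in> G \<and> G \<subseteq> preim P U"
proof (cases x)
  case (DNode n)
  then show ?thesis
    using preim_nbhd_vertex[OF assms(1,2)] preim_nbhd_end[OF assms(1,2)] assms(3) by (cases n) auto
next
  case (DInner e t)
  then show ?thesis using preim_nbhd_inner[OF assms(1,2)] assms(3) by blast
qed

lemma openin_preim:
  assumes "P \<in> adm_parts V E" "locally_open P U"
  shows "openin (DTop V E) (preim P U)"
proof (subst openin_subopen, intro ballI)
  fix x assume "x \<in> preim P U"
  then obtain G where "G \<in> gen_sets V E" "x \<in> G" "G \<subseteq> preim P U"
    using preim_nbhd[OF assms] by blast
  then show "\<exists>T. openin (DTop V E) T \<and> x \<in> T \<and> T \<subseteq> preim P U"
    unfolding DTop_def using topology_generated_by_Basis by blast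
qed

lemma topspace_DTop: "topspace (DTop V E) = points"
proof
  have "G \<subseteq> points" if G: "G \<in> gen_sets V E" for G
  proof -
    obtain P U where "P \<in> adm_parts V E" "openin (QTop V E P) U" "G = preim P U"
      by (rule generator_preim[OF G])
    then show ?thesis unfolding preim_def by auto
  qed
  then show "topspace (DTop V E) \<subseteq> points"
    unfolding DTop_def topology_generated_by_topspace by blast
next
  \<comment> \<open>The empty set merely supplies some admissible partition: \<open>points\<close>
    is the preimage of the carrier of any quotient.\<close>
  have P: "parts {} \<in> adm_parts V E" by (rule parts_adm) (simp add: fin_sets_def)
  have "points = preim (parts {}) (qpoints (parts {}))"
    using phi_in_qpoints[OF P] unfolding preim_def by blast
  then show "points \<subseteq> topspace (DTop V E)"
    using openin_preim[OF P locally_open_qpoints] openin_subset by metis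
qed

lemma continuous_phi:
  assumes "P \<in> adm_parts V E"
  shows "continuous_map (DTop V E) (QTop V E P) (phi V E P)"
  unfolding QTop_def
proof (rule continuous_on_generated_topo)
  fix U assume "U \<in> {qstar V E P p \<epsilon> | p \<epsilon>. p \<in> P \<and> 0 < \<epsilon> \<and> \<epsilon> < 1}
      \<union> {qint e a b | e a b. e \<in> qedges V E P \<and> 0 \<le> a \<and> a < b \<and> b \<le> 1}"
  then have "locally_open P U" using locally_open_qstar locally_open_qint by blast
  then have "openin (DTop V E) (preim P U)" by (rule openin_preim[OF assms])
  moreover have "phi V E P -` U \<inter> topspace (DTop V E) = preim P U"
    unfolding topspace_DTop preim_def by auto
  ultimately show "openin (DTop V E) (phi V E P -` U \<inter> topspace (DTop V E))" by simp
next
  show "phi V E P ` topspace (DTop V E) \<subseteq> \<Union>({qstar V E P p \<epsilon> | p \<epsilon>. p \<in> P \<and> 0 < \<epsilon> \<and> \<epsilon> < 1}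
      \<union> {qint e a b | e a b. e \<in> qedges V E P \<and> 0 \<le> a \<and> a < b \<and> b \<le> 1})"
    using phi_in_qpoints[OF assms] topspace_QTop[of P]
    unfolding topspace_DTop QTop_def topology_generated_by_topspace by blast
qed

end

section \<open>Every direction is represented by an end\<close>

lemma rtrancl_last_visit:
  assumes "(v, w) \<in> Q\<^sup>*"
  shows "w = v \<or> (\<exists>v'. (v, v') \<in> Q \<and> v' \<noteq> v \<and> (v', w) \<in> (Q \<inter> (- {v}) \<times> (- {v}))\<^sup>*)"
  using assms
proof (induction rule: rtrancl_induct)
  case base
  then show ?case by simp
next
  case (step y z)
  show ?case
  proof (cases "z = v \<or> y = v")
    case True
    then show ?thesis using step.hyps(2) by auto
  next
    case False
    then obtain v' where v': "(v, v') \<in> Q" "v' \<noteq> v" "(v', y) \<in> (Q \<inter> (- {v}) \<times> (- {v}))\<^sup>*"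
      using step.IH by auto
    have "(y, z) \<in> Q \<inter> (- {v}) \<times> (- {v})" using step.hyps(2) False by simp
    from rtrancl_into_rtrancl[OF v'(3) this] show ?thesis using v' by blast
  qed
qed

text \<open>\<open>F\<close> holds the vertices already used. Cutting each walk from
  \<open>v\<close> at its last visit to \<open>v\<close> shows that its end is \<open>v\<close> or
  reachable from an out-neighbour while avoiding \<open>insert v F\<close>; as there are finitely
  many out-neighbours, one of them reaches infinitely many vertices.\<close>

lemma konig_step:
  fixes R :: "('a \<times> 'a) set"
  assumes "finite (R `` {v})" "infinite {w. (v, w) \<in> (R \<inter> (- F) \<times> (- F))\<^sup>*}"
  shows "\<exists>v'. (v, v') \<in> R \<and> v' \<notin> insert v F \<and>
    infinite {w. (v', w) \<in> (R \<inter> (- insert v F) \<times> (- insert v F))\<^sup>*}"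
proof (rule ccontr)
  assume neg: "\<not> ?thesis"
  let ?S = "{v'. (v, v') \<in> R \<and> v' \<notin> insert v F}"
  let ?T = "\<lambda>v'. {w. (v', w) \<in> (R \<inter> (- insert v F) \<times> (- insert v F))\<^sup>*}"
  have "finite ?S" by (rule finite_subset[OF _ assms(1)]) auto
  moreover have "finite (?T v')" if "v' \<in> ?S" for v'
    using neg that by blast
  ultimately have "finite (insert v (\<Union>v'\<in>?S. ?T v'))" by (intro finite.insertI finite_UN_I)
  moreover have "{w. (v, w) \<in> (R \<inter> (- F) \<times> (- F))\<^sup>*} \<subseteq> insert v (\<Union>v'\<in>?S. ?T v')"
  proof
    fix w assume "w \<in> {w. (v, w) \<in> (R \<inter> (- F) \<times> (- F))\<^sup>*}"
    then have "(v, w) \<in> (R \<inter> (- F) \<times> (- F))\<^sup>*" by simp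
    from rtrancl_last_visit[OF this]
    show "w \<in> insert v (\<Union>v'\<in>?S. ?T v')"
    proof (elim disjE exE conjE)
      fix v' assume v': "(v, v') \<in> R \<inter> (- F) \<times> (- F)" "v' \<noteq> v"
        "(v', w) \<in> (R \<inter> (- F) \<times> (- F) \<inter> (- {v}) \<times> (- {v}))\<^sup>*"
      have "R \<inter> (- F) \<times> (- F) \<inter> (- {v}) \<times> (- {v}) = R \<inter> (- insert v F) \<times> (- insert v F)" by auto
      then have "w \<in> ?T v'" "v' \<in> ?S" using v' by auto
      then show ?thesis by blast
    qed simp
  qed
  ultimately show False using assms(2) finite_subset by blast
qed

lemma konig:
  fixes R :: "('a \<times> 'a) set"
  assumes fin: "\<And>v. finite (R `` {v})" and inf: "infinite (R\<^sup>* `` {a})"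
  shows "\<exists>r. inj r \<and> (\<forall>n. (r n, r (Suc n)) \<in> R)"
proof -
  \<comment> \<open>States pair the current vertex with the set of earlier ones; the growth of this
    set yields injectivity.\<close>
  define P where "P s \<longleftrightarrow> fst s \<notin> snd s \<and>
    infinite {w. (fst s, w) \<in> (R \<inter> (- snd s) \<times> (- snd s))\<^sup>*}" for s :: "'a \<times> 'a set"
  have "R\<^sup>* `` {a} = {w. (a, w) \<in> R\<^sup>*}" by auto
  then have "P (a, {})" unfolding P_def using inf by simp
  moreover have "\<exists>s'. P s' \<and> ((fst s, fst s') \<in> R \<and> snd s' = insert (fst s) (snd s))" if "P s" for s
    using konig_step[OF fin, of "fst s" "snd s"] that unfolding P_def by fastforce
  ultimately obtain s where s: "\<And>n. P (s n)"
    "\<And>n. (fst (s n), fst (s (Suc n))) \<in> R \<and> snd (s (Suc n)) = insert (fst (s n)) (snd (s n))"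
    using dependent_nat_choice[of "\<lambda>_. P" "\<lambda>_ s s'. (fst s, fst s') \<in> R \<and> snd s' = insert (fst s) (snd s)"]
    by blast
  have mem: "fst (s m) \<in> snd (s (Suc (m + k)))" for m k
    by (induction k) (use s(2) in auto)
  have neq: "fst (s m) \<noteq> fst (s n)" if "m < n" for m n
  proof -
    obtain k where "n = Suc (m + k)" using less_imp_Suc_add[OF \<open>m < n\<close>] by blast
    then show ?thesis using mem[of m k] s(1)[of n] unfolding P_def by auto
  qed
  then have "inj (\<lambda>n. fst (s n))" by (intro injI) (metis linorder_neqE_nat)
  then show ?thesis using s(2) by blast
qed

text \<open>\<open>W\<close> is the vertex set of a single walk from \<open>u\<close> to
  \<open>v\<close>.\<close>

lemma rtrancl_finite:
  assumes "(u, v) \<in> R\<^sup>*"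
  shows "\<exists>W. finite W \<and> u \<in> W \<and> v \<in> W \<and> (\<forall>w\<in>W. (u, w) \<in> (R \<inter> W \<times> W)\<^sup>* \<and> (w, v) \<in> (R \<inter> W \<times> W)\<^sup>*)"
  using assms
proof (induction rule: rtrancl_induct)
  case base
  then show ?case by (intro exI[of _ "{u}"]) auto
next
  case (step y z)
  then obtain W where W: "finite W" "u \<in> W" "y \<in> W"
    "\<And>w. w \<in> W \<Longrightarrow> (u, w) \<in> (R \<inter> W \<times> W)\<^sup>* \<and> (w, y) \<in> (R \<inter> W \<times> W)\<^sup>*" by blast
  define W' where "W' = insert z W"
  have sub: "(R \<inter> W \<times> W)\<^sup>* \<subseteq> (R \<inter> W' \<times> W')\<^sup>*" unfolding W'_def by (rule rtrancl_mono) auto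
  have e: "(y, z) \<in> R \<inter> W' \<times> W'" using step.hyps(2) W(3) unfolding W'_def by simp
  have "(u, w) \<in> (R \<inter> W' \<times> W')\<^sup>* \<and> (w, z) \<in> (R \<inter> W' \<times> W')\<^sup>*" if "w \<in> W" for w
    using W(4)[OF that] sub e by (meson rtrancl.rtrancl_into_rtrancl subsetD)
  moreover from this[OF W(3)] have "(u, z) \<in> (R \<inter> W' \<times> W')\<^sup>*" using e by (meson rtrancl.rtrancl_into_rtrancl)
  ultimately have "\<forall>w\<in>W'. (u, w) \<in> (R \<inter> W' \<times> W')\<^sup>* \<and> (w, z) \<in> (R \<inter> W' \<times> W')\<^sup>*"
    unfolding W'_def by auto
  then show ?case using W(1,2) unfolding W'_def by (intro exI[of _ "insert z W"]) simp
qed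

lemma finite_subset_UN_mono:
  fixes X :: "nat \<Rightarrow> 'a set"
  assumes "finite S" "S \<subseteq> (\<Union>n. X n)" "\<And>m n. m \<le> n \<Longrightarrow> X m \<subseteq> X n"
  shows "\<exists>n. S \<subseteq> X n"
  using assms(1,2)
proof (induction S rule: finite_induct)
  case (insert x S)
  then obtain m n where "S \<subseteq> X m" "x \<in> X n" by auto
  then have "insert x S \<subseteq> X (max m n)"
    using assms(3)[of m "max m n"] assms(3)[of n "max m n"] by auto
  then show ?case by blast
qed simp

context solid_digraph
begin

section \<open>Finite strongly connected sets inside components\<close>

definition strong_set :: "'v set \<Rightarrow> bool" where
  "strong_set W \<longleftrightarrow> (\<forall>u\<in>W. \<forall>w\<in>W. (u, w) \<in> (E \<inter> W \<times> W)\<^sup>*)"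

text \<open>A \<open>strong_set\<close> connects its vertices by edges within itself only, so it
  survives the deletion of any vertices outside it and stays in one component.\<close>

lemma strong_set_in_comp:
  assumes "strong_set W" "W \<subseteq> V - X" "C \<in> strong_comps V E X" "u \<in> W" "u \<in> C"
  shows "W \<subseteq> C"
proof
  fix w assume w: "w \<in> W"
  have "(E \<inter> W \<times> W)\<^sup>* \<subseteq> (rel X)\<^sup>*" by (rule rtrancl_mono) (use assms(2) in auto)
  then have "reach V E X u w" "reach V E X w u"
    using assms(1,4) w unfolding strong_set_def reach_def by auto
  then show "w \<in> C" using strong_comps_closed[OF assms(3,5)] by simp
qed

text \<open>Take the vertices of a walk from \<open>u\<close> to \<open>w\<close> and of a walk
  back. They are all mutually reachable with \<open>u\<close> in \<open>D - X\<close>, hence lie in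
  \<open>C\<close>.\<close>

lemma comp_finite_strong_set:
  assumes C: "C \<in> strong_comps V E X" and "u \<in> C" "w \<in> C"
  obtains W where "finite W" "W \<subseteq> C" "u \<in> W" "w \<in> W" "strong_set W"
proof -
  have uw: "(u, w) \<in> (rel X)\<^sup>*" "(w, u) \<in> (rel X)\<^sup>*"
    using strong_comps_reach[OF C] assms(2,3) unfolding reach_def by auto
  obtain W1 where W1: "finite W1" "u \<in> W1" "w \<in> W1"
    "\<And>z. z \<in> W1 \<Longrightarrow> (u, z) \<in> (rel X \<inter> W1 \<times> W1)\<^sup>* \<and> (z, w) \<in> (rel X \<inter> W1 \<times> W1)\<^sup>*"
    using rtrancl_finite[OF uw(1)] by blast
  obtain W2 where W2: "finite W2" "w \<in> W2" "u \<in> W2"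
    "\<And>z. z \<in> W2 \<Longrightarrow> (w, z) \<in> (rel X \<inter> W2 \<times> W2)\<^sup>* \<and> (z, u) \<in> (rel X \<inter> W2 \<times> W2)\<^sup>*"
    using rtrancl_finite[OF uw(2)] by blast
  define W where "W = W1 \<union> W2"
  define Q where "Q = rel X \<inter> W \<times> W"
  have sub: "(rel X \<inter> W1 \<times> W1)\<^sup>* \<subseteq> Q\<^sup>*" "(rel X \<inter> W2 \<times> W2)\<^sup>* \<subseteq> Q\<^sup>*"
    unfolding Q_def W_def by (rule rtrancl_mono; auto)+
  have uw': "(u, w) \<in> Q\<^sup>*" "(w, u) \<in> Q\<^sup>*" using W1(4)[OF W1(3)] W2(4)[OF W2(3)] sub by auto
  have Q: "(u, z) \<in> Q\<^sup>* \<and> (z, u) \<in> Q\<^sup>*" if "z \<in> W" for z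
  proof (cases "z \<in> W1")
    case True
    then have "(u, z) \<in> Q\<^sup>*" "(z, w) \<in> Q\<^sup>*" using W1(4)[OF True] sub by auto
    then show ?thesis using uw'(2) rtrancl_trans by metis
  next
    case False
    then have "z \<in> W2" using that unfolding W_def by simp
    then have "(w, z) \<in> Q\<^sup>*" "(z, u) \<in> Q\<^sup>*" using W2(4) sub by auto
    then show ?thesis using uw'(1) rtrancl_trans by metis
  qed
  have "Q\<^sup>* \<subseteq> (E \<inter> W \<times> W)\<^sup>*" unfolding Q_def by (rule rtrancl_mono) auto
  moreover have "(z, z') \<in> Q\<^sup>*" if "z \<in> W" "z' \<in> W" for z z'
    using Q[OF that(1)] Q[OF that(2)] rtrancl_trans by metis
  ultimately have "strong_set W" unfolding strong_set_def by blast
  moreover have "W \<subseteq> C"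
  proof
    fix z assume "z \<in> W"
    moreover have "Q\<^sup>* \<subseteq> (rel X)\<^sup>*" unfolding Q_def by (rule rtrancl_mono) auto
    ultimately have "reach V E X u z" "reach V E X z u" using Q unfolding reach_def by auto
    then show "z \<in> C" using strong_comps_closed[OF C assms(2)] by simp
  qed
  ultimately show thesis using that[of W] W1 W2 unfolding W_def by simp
qed

text \<open>The deleted sets \<open>X\<close> and \<open>Z\<close> need not be comparable: a
  component avoiding \<open>Z\<close> is exhausted by finite strongly connected sets through
  \<open>u\<close>, none of which is broken by deleting \<open>Z\<close>.\<close>

lemma comp_subset_comp:
  assumes "C \<in> strong_comps V E X" "C \<inter> Z = {}" "C' \<in> strong_comps V E Z" "u \<in> C" "u \<in> C'"
  shows "C \<subseteq> C'"
proof
  fix w assume "w \<in> C"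
  then obtain W where W: "W \<subseteq> C" "u \<in> W" "w \<in> W" "strong_set W"
    using comp_finite_strong_set[OF assms(1,4)] by metis
  have "W \<subseteq> V - Z" using W(1) assms(2) strong_comps_subset[OF assms(1)] by auto
  then show "w \<in> C'" using strong_set_in_comp[OF W(4) _ assms(3) W(2) assms(5)] W(3) by auto
qed

section \<open>Directions, chains, and the ray of a direction\<close>

definition direction :: "('v set \<Rightarrow> 'v set) \<Rightarrow> bool" where
  "direction f \<longleftrightarrow> (\<forall>X\<in>fin_sets V. f X \<in> strong_comps V E X) \<and>
     (\<forall>X\<in>fin_sets V. \<forall>X'\<in>fin_sets V. X \<subseteq> X' \<longrightarrow> f X' \<subseteq> f X)"

text \<open>The parameter \<open>G\<close> prescribes vertices to be deleted in the next step: hitting sets in one case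
of the construction, the sets \<open>Y\<^sub>i\<close> in the other.\<close>

definition chain :: "('v set \<Rightarrow> 'v set) \<Rightarrow> (nat \<Rightarrow> 'v set \<Rightarrow> 'v \<Rightarrow> 'v set) \<Rightarrow>
    (nat \<Rightarrow> 'v set) \<Rightarrow> (nat \<Rightarrow> 'v) \<Rightarrow> (nat \<Rightarrow> 'v set) \<Rightarrow> bool" where
  "chain f G X a W \<longleftrightarrow> (\<forall>n. X n \<in> fin_sets V \<and> a n \<in> f (X n) \<and>
     finite (W n) \<and> W n \<subseteq> f (X n) \<and> a n \<in> W n \<and> a (Suc n) \<in> W n \<and> strong_set (W n) \<and>
     X n \<subseteq> X (Suc n) \<and> G n (X n) (a n) \<subseteq> X (Suc n) \<and> W n \<subseteq> X (Suc (Suc n)))"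

lemma directionD:
  assumes "direction f" "X \<in> fin_sets V"
  shows "f X \<in> strong_comps V E X" "f X \<subseteq> V - X" "\<exists>a. a \<in> f X"
proof -
  show C: "f X \<in> strong_comps V E X" using assms unfolding direction_def by simp
  show "f X \<subseteq> V - X" by (rule strong_comps_subset[OF C])
  show "\<exists>a. a \<in> f X" using strong_comps_nonempty[OF C] by blast
qed

lemma direction_mono:
  assumes "direction f" "X' \<in> fin_sets V" "X \<subseteq> X'"
  shows "f X' \<subseteq> f X"
proof -
  have "X \<in> fin_sets V" using assms(2,3) finite_subset unfolding fin_sets_def by auto
  then show ?thesis using assms unfolding direction_def by simp
qed

lemma chain_exists:
  assumes f: "direction f" and G: "\<And>n X a. X \<in> fin_sets V \<Longrightarrow> a \<in> f X \<Longrightarrow> G n X a \<in> fin_sets V"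
  shows "\<exists>X a W. chain f G X a W"
proof -
  define P where "P s \<longleftrightarrow> (case s of (X, a, W) \<Rightarrow> X \<in> fin_sets V \<and> a \<in> f X \<and> W \<in> fin_sets V)"
    for s :: "'v set \<times> 'v \<times> 'v set"
  define Q where "Q n s s' \<longleftrightarrow> (case s of (X, a, W) \<Rightarrow> case s' of (X', a', W') \<Rightarrow>
    X' = X \<union> W \<union> G n X a \<and> W' \<subseteq> f X \<and> a \<in> W' \<and> a' \<in> W' \<and> strong_set W')"
    for n and s s' :: "'v set \<times> 'v \<times> 'v set"
  have emp: "{} \<in> fin_sets V" unfolding fin_sets_def by simp
  obtain a0 where "a0 \<in> f {}" using directionD(3)[OF f emp] by blast
  then have "P ({}, a0, {})" using emp unfolding P_def by simp
  moreover have "\<exists>s'. P s' \<and> Q n s s'" if "P s" for n s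
  proof -
    obtain X a W where s: "s = (X, a, W)" by (cases s)
    then have XaW: "X \<in> fin_sets V" "a \<in> f X" "W \<in> fin_sets V" using that unfolding P_def by auto
    define X' where "X' = X \<union> W \<union> G n X a"
    have X': "X' \<in> fin_sets V"
      using XaW(1,3) G[OF XaW(1,2), of n] unfolding X'_def fin_sets_def by auto
    \<comment> \<open>The next base point is chosen first, outside \<open>X'\<close>, and then
      joined to the current one inside \<open>f X\<close>. As \<open>W'\<close> contains
      \<open>a'\<close>, it can be deleted only one stage later.\<close>
    obtain a' where a': "a' \<in> f X'" using directionD(3)[OF f X'] by blast
    then have "a' \<in> f X" using direction_mono[OF f X', of X] unfolding X'_def by auto
    then obtain W' where W': "finite W'" "W' \<subseteq> f X" "a \<in> W'" "a' \<in> W'" "strong_set W'"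
      using comp_finite_strong_set[OF directionD(1)[OF f XaW(1)] XaW(2)] by metis
    have "W' \<in> fin_sets V" using W'(1,2) directionD(2)[OF f XaW(1)] unfolding fin_sets_def by auto
    then have "P (X', a', W') \<and> Q n s (X', a', W')"
      using X' a' W' unfolding P_def Q_def s X'_def by simp
    then show ?thesis by blast
  qed
  ultimately obtain s where s: "\<And>n. P (s n)" "\<And>n. Q n (s n) (s (Suc n))"
    using dependent_nat_choice[of "\<lambda>_. P" Q] by blast
  \<comment> \<open>The set joining \<open>a n\<close> to \<open>a (Suc n)\<close> is stored in
    state \<open>Suc n\<close>, hence the shift; the empty set of the initial state is
    dropped.\<close>
  have "chain f G (\<lambda>n. fst (s n)) (\<lambda>n. fst (snd (s n))) (\<lambda>n. snd (snd (s (Suc n))))"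
    unfolding chain_def
  proof
    fix n
    show "fst (s n) \<in> fin_sets V \<and> fst (snd (s n)) \<in> f (fst (s n)) \<and>
      finite (snd (snd (s (Suc n)))) \<and> snd (snd (s (Suc n))) \<subseteq> f (fst (s n)) \<and>
      fst (snd (s n)) \<in> snd (snd (s (Suc n))) \<and> fst (snd (s (Suc n))) \<in> snd (snd (s (Suc n))) \<and>
      strong_set (snd (snd (s (Suc n)))) \<and> fst (s n) \<subseteq> fst (s (Suc n)) \<and>
      G n (fst (s n)) (fst (snd (s n))) \<subseteq> fst (s (Suc n)) \<and>
      snd (snd (s (Suc n))) \<subseteq> fst (s (Suc (Suc n)))"
      using s(1)[of n] s(1)[of "Suc n"] s(2)[of n] s(2)[of "Suc n"]
      unfolding P_def Q_def by (auto simp: split_beta fin_sets_def)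
  qed
  then show ?thesis by blast
qed

lemma chainD:
  assumes "chain f G X a W"
  shows "X n \<in> fin_sets V" "a n \<in> f (X n)" "finite (W n)" "W n \<subseteq> f (X n)" "a n \<in> W n"
    "a (Suc n) \<in> W n" "strong_set (W n)" "X n \<subseteq> X (Suc n)" "G n (X n) (a n) \<subseteq> X (Suc n)"
    "W n \<subseteq> X (Suc (Suc n))"
  using assms unfolding chain_def by blast+

lemma chain_mono: "chain f G X a W \<Longrightarrow> m \<le> n \<Longrightarrow> X m \<subseteq> X n"
  using chainD(8) lift_Suc_mono_le by metis

text \<open>Each \<open>W k\<close> is deleted from stage \<open>k + 2\<close> on, so a vertex lies
  in only finitely many \<open>W m\<close> and the union \<open>R\<close> of their edges is locally
  finite. Consecutive sets overlap in \<open>a (Suc n)\<close>, so infinitely many vertices are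
  reachable from \<open>a 0\<close>, and Koenig's lemma gives a ray in \<open>R\<close>. Being
  injective, it eventually leaves any finitely many \<open>W m\<close>, and \<open>conv\<close>
  places the rest in \<open>f Y\<close>.\<close>

lemma chain_ray:
  assumes f: "direction f" and ch: "chain f G X a W"
    and conv: "\<And>Y. Y \<in> fin_sets V \<Longrightarrow> \<exists>n. \<forall>m\<ge>n. W m \<subseteq> f Y"
  shows "\<exists>r. ray V E r \<and> (\<forall>Y\<in>fin_sets V. tail_in r (f Y))"
proof -
  note c = chainD[OF ch]
  have bound: "m \<le> Suc k" if "v \<in> W k" "v \<in> W m" for v k m
  proof (rule ccontr)
    assume "\<not> m \<le> Suc k"
    then have "X (Suc (Suc k)) \<subseteq> X m" using chain_mono[OF ch] by simp
    then have "v \<in> X m" using that(1) c(10)[of k] by auto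
    then show False using that(2) c(4)[of m] directionD(2)[OF f c(1)[of m]] by auto
  qed
  have fin: "finite {m. v \<in> W m}" for v
  proof (cases "\<exists>k. v \<in> W k")
    case True
    then obtain k where "v \<in> W k" by blast
    then have "{m. v \<in> W m} \<subseteq> {..Suc k}" using bound by auto
    then show ?thesis using finite_subset by blast
  qed simp
  define R where "R = (\<Union>n. E \<inter> W n \<times> W n)"
  have "finite (R `` {v})" for v
  proof -
    have "R `` {v} \<subseteq> (\<Union>m\<in>{m. v \<in> W m}. W m)" unfolding R_def by auto
    moreover have "finite (\<Union>m\<in>{m. v \<in> W m}. W m)" by (rule finite_UN_I[OF fin c(3)])
    ultimately show ?thesis by (rule finite_subset)
  qed
  moreover have "infinite (R\<^sup>* `` {a 0})"
  proof
    assume finR: "finite (R\<^sup>* `` {a 0})"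
    have W: "(u, w) \<in> R\<^sup>*" if "u \<in> W n" "w \<in> W n" for u w n
    proof -
      have "(E \<inter> W n \<times> W n)\<^sup>* \<subseteq> R\<^sup>*" unfolding R_def by (rule rtrancl_mono) auto
      then show ?thesis using c(7)[of n] that unfolding strong_set_def by blast
    qed
    have "(a 0, a n) \<in> R\<^sup>*" for n
    proof (induction n)
      case (Suc n)
      then show ?case using W[OF c(5,6)] by (rule rtrancl_trans)
    qed simp
    then have "UNIV \<subseteq> (\<Union>v\<in>R\<^sup>* `` {a 0}. {m. v \<in> W m})" using c(5) by blast
    moreover have "finite (\<Union>v\<in>R\<^sup>* `` {a 0}. {m. v \<in> W m})" by (rule finite_UN_I[OF finR fin])
    ultimately show False using finite_subset[of UNIV] infinite_UNIV_nat by metis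
  qed
  ultimately obtain r where r: "inj r" "\<And>n. (r n, r (Suc n)) \<in> R"
    using konig[of R "a 0"] by blast
  have rE: "(r n, r (Suc n)) \<in> E" for n using r(2)[of n] unfolding R_def by auto
  then have "ray V E r" using r(1) edge_in unfolding ray_def by blast
  moreover have "tail_in r (f Y)" if Y: "Y \<in> fin_sets V" for Y
  proof -
    obtain n where n: "\<And>m. m \<ge> n \<Longrightarrow> W m \<subseteq> f Y" using conv[OF Y] by blast
    have "finite (\<Union>m\<in>{..<n}. W m)" using c(3) by auto
    then have "finite (r -` (\<Union>m\<in>{..<n}. W m))" using r(1) by (rule finite_vimageI)
    then obtain k where k: "\<And>i. i \<in> r -` (\<Union>m\<in>{..<n}. W m) \<Longrightarrow> i < k"
      using finite_nat_set_iff_bounded by metis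
    have "r i \<in> f Y" if "i \<ge> k" for i
    proof -
      obtain m where m: "r i \<in> W m" using r(2)[of i] unfolding R_def by auto
      have "\<not> m < n" using k[of i] that m by auto
      then show ?thesis using n[of m] m by auto
    qed
    then show ?thesis unfolding tail_in_def by blast
  qed
  ultimately show ?thesis by blast
qed

text \<open>\<open>H\<close> is a finite hitting set for the finite sets that cut \<open>x\<close>
  off relative to \<open>X\<close>.\<close>

definition hit :: "('v set \<Rightarrow> 'v set) \<Rightarrow> 'v set \<Rightarrow> 'v \<Rightarrow> 'v set \<Rightarrow> bool" where
  "hit f X x H \<longleftrightarrow> H \<in> fin_sets V \<and>
     (\<forall>Y\<in>fin_sets V. x \<notin> Y \<longrightarrow> x \<notin> f (X \<union> Y) \<longrightarrow> Y \<inter> H \<noteq> {})"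

text \<open>Let \<open>M\<close> be the union of all \<open>X n\<close>. The part of
  \<open>Z\<close> in \<open>M\<close> lies in some \<open>X n\<close>; the rest misses
  \<open>M\<close> and so the hitting set for \<open>a n\<close>, hence does not cut
  \<open>a n\<close> off. Thus \<open>a n\<close> lies in \<open>f Z\<close>. From stage
  \<open>n\<close> on the sets \<open>W m\<close> avoid \<open>Z\<close>, and their overlaps carry
  membership in \<open>f Z\<close> along the chain.\<close>

lemma direction_ray_hit:
  assumes f: "direction f" and H: "\<And>X x. X \<in> fin_sets V \<Longrightarrow> x \<in> f X \<Longrightarrow> \<exists>H. hit f X x H"
  shows "\<exists>r. ray V E r \<and> (\<forall>Y\<in>fin_sets V. tail_in r (f Y))"
proof -
  define G where "G n X x = (SOME H. hit f X x H)" for n :: nat and X x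
  have G: "hit f X x (G n X x)" if "X \<in> fin_sets V" "x \<in> f X" for n X x
    unfolding G_def using H[OF that] by (rule someI_ex)
  then have "\<exists>X a W. chain f G X a W" by (intro chain_exists[OF f]) (simp add: hit_def)
  then obtain X a W where ch: "chain f G X a W" by blast
  note c = chainD[OF ch]
  have "\<exists>n. \<forall>m\<ge>n. W m \<subseteq> f Z" if Z: "Z \<in> fin_sets V" for Z
  proof -
    define M where "M = (\<Union>n. X n)"
    have "\<exists>n. Z \<inter> M \<subseteq> X n"
      by (rule finite_subset_UN_mono) (use Z chain_mono[OF ch] in \<open>auto simp: M_def fin_sets_def\<close>)
    then obtain n where n: "Z \<inter> M \<subseteq> X n" by blast
    have sub: "W k \<subseteq> M" "X k \<subseteq> M" for k using c(10)[of k] unfolding M_def by auto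
    define Y where "Y = Z - X n"
    have Y: "Y \<in> fin_sets V" "Y \<inter> M = {}" using Z n unfolding Y_def fin_sets_def by auto
    have "Y \<inter> G n (X n) (a n) = {}" using Y(2) c(9)[of n] sub(2)[of "Suc n"] by auto
    moreover have "a n \<notin> Y" using c(5)[of n] sub(1)[of n] Y(2) by auto
    ultimately have "a n \<in> f (X n \<union> Y)"
      using G[OF c(1,2), of n n] Y(1) unfolding hit_def by blast
    moreover have "Z \<subseteq> X n \<union> Y" unfolding Y_def by auto
    ultimately have an: "a n \<in> f Z" using direction_mono[OF f fin_sets_Un[OF c(1) Y(1)]] by blast
    have Wm: "W m \<subseteq> f Z" if "a m \<in> f Z" "n \<le> m" for m
    proof -
      have "W m \<inter> X m = {}" "W m \<subseteq> V" using c(4)[of m] directionD(2)[OF f c(1)[of m]] by auto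
      then have "W m \<subseteq> V - Z" using n sub(1)[of m] chain_mono[OF ch that(2)] by blast
      then show ?thesis
        using strong_set_in_comp[OF c(7) _ directionD(1)[OF f Z] c(5) that(1)] by simp
    qed
    have "a (n + k) \<in> f Z" for k
    proof (induction k)
      case (Suc k)
      then show ?case using Wm[of "n + k"] c(6)[of "n + k"] by auto
    qed (simp add: an)
    then have "\<forall>m\<ge>n. W m \<subseteq> f Z" using Wm le_Suc_ex by metis
    then show ?thesis by blast
  qed
  then show ?thesis by (rule chain_ray[OF f ch])
qed

text \<open>Without a hitting set there are pairwise disjoint sets \<open>Y i\<close>, each cutting
  \<open>x\<close> off. A vertex lies in only finitely many \<open>f (X0 \<union> Y i)\<close>, so a
  given finite \<open>Z\<close> is avoided by one of these components, which is then contained in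
  \<open>f Z\<close>.\<close>

lemma direction_ray_no_hit:
  assumes f: "direction f" and X0: "X0 \<in> fin_sets V" and x: "x \<in> f X0" and nohit: "\<And>H. \<not> hit f X0 x H"
  shows "\<exists>r. ray V E r \<and> (\<forall>Y\<in>fin_sets V. tail_in r (f Y))"
proof -
  \<comment> \<open>The second component contains all sets chosen so far; the next set is taken
    disjoint from it.\<close>
  define P where "P s \<longleftrightarrow> fst s \<in> fin_sets V \<and> snd s \<in> fin_sets V \<and> fst s \<subseteq> snd s \<and>
    x \<notin> fst s \<and> x \<notin> f (X0 \<union> fst s)" for s :: "'v set \<times> 'v set"
  have step: "\<exists>s'. P s' \<and> H \<subseteq> snd s' \<and> fst s' \<inter> H = {}" if H: "H \<in> fin_sets V" for H
  proof -
    obtain Y where "Y \<in> fin_sets V" "x \<notin> Y" "x \<notin> f (X0 \<union> Y)" "Y \<inter> H = {}"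
      using nohit[of H] H unfolding hit_def by blast
    then have "P (Y, Y \<union> H) \<and> H \<subseteq> snd (Y, Y \<union> H) \<and> fst (Y, Y \<union> H) \<inter> H = {}"
      using H fin_sets_Un unfolding P_def by auto
    then show ?thesis by blast
  qed
  have "\<exists>s. P s" using step[of "{}"] unfolding fin_sets_def by auto
  moreover have "\<exists>s'. P s' \<and> (snd s \<subseteq> snd s' \<and> fst s' \<inter> snd s = {})" if "P s" for s
    using step[of "snd s"] that unfolding P_def by auto
  ultimately obtain s where s: "\<And>n. P (s n)"
    "\<And>n. snd (s n) \<subseteq> snd (s (Suc n)) \<and> fst (s (Suc n)) \<inter> snd (s n) = {}"
    using dependent_nat_choice[of "\<lambda>_. P" "\<lambda>_ s s'. snd s \<subseteq> snd s' \<and> fst s' \<inter> snd s = {}"] by blast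
  define Y where "Y n = fst (s n)" for n
  have Y: "Y n \<in> fin_sets V" "x \<notin> Y n" "x \<notin> f (X0 \<union> Y n)" for n
    using s(1)[of n] unfolding P_def Y_def by auto
  have disj: "Y m \<inter> Y n = {}" if "m < n" for m n
  proof -
    obtain k where k: "n = Suc k" "m \<le> k" using \<open>m < n\<close> by (cases n) auto
    have "snd (s m) \<subseteq> snd (s k)" using lift_Suc_mono_le[of "\<lambda>n. snd (s n)"] s(2) k(2) by blast
    then have "Y m \<subseteq> snd (s k)" using s(1)[of m] unfolding P_def Y_def by auto
    then show ?thesis using s(2)[of k] k(1) unfolding Y_def by auto
  qed
  have fin1: "finite {i. w \<in> Y i}" for w
  proof (cases "\<exists>k. w \<in> Y k")
    case True
    then obtain k where "w \<in> Y k" by blast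
    then have "{i. w \<in> Y i} \<subseteq> {..k}" using disj not_le_imp_less by blast
    then show ?thesis using finite_subset by blast
  qed simp
  have XY: "X0 \<union> Y i \<in> fin_sets V" for i using fin_sets_Un[OF X0 Y(1)] .
  have fin: "finite {i. v \<in> f (X0 \<union> Y i)}" for v
  proof (cases "v \<in> f X0")
    case True
    then obtain W where W: "finite W" "W \<subseteq> f X0" "v \<in> W" "x \<in> W" "strong_set W"
      using comp_finite_strong_set[OF directionD(1)[OF f X0] _ x] by metis
    have "{i. v \<in> f (X0 \<union> Y i)} \<subseteq> (\<Union>w\<in>W. {i. w \<in> Y i})"
    proof
      fix i assume i: "i \<in> {i. v \<in> f (X0 \<union> Y i)}"
      show "i \<in> (\<Union>w\<in>W. {i. w \<in> Y i})"
      proof (rule ccontr)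
        assume "\<not> ?thesis"
        then have "W \<subseteq> V - (X0 \<union> Y i)" using W(2) directionD(2)[OF f X0] by auto
        then have "W \<subseteq> f (X0 \<union> Y i)"
          using strong_set_in_comp[OF W(5) _ directionD(1)[OF f XY] W(3)] i by auto
        then show False using W(4) Y(3) by auto
      qed
    qed
    moreover have "finite (\<Union>w\<in>W. {i. w \<in> Y i})" by (rule finite_UN_I[OF W(1) fin1])
    ultimately show ?thesis by (rule finite_subset)
  next
    case False
    then have "{i. v \<in> f (X0 \<union> Y i)} = {}" using direction_mono[OF f XY, of X0] by auto
    then show ?thesis by simp
  qed
  \<comment> \<open>Deleting \<open>X0 \<union> Y n\<close> at stage \<open>n\<close> forces all
    later \<open>W m\<close> into \<open>f (X0 \<union> Y n)\<close>.\<close>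
  define G where "G n X a = X0 \<union> Y n" for n and X :: "'v set" and a :: 'v
  have "\<exists>X a W. chain f G X a W" by (intro chain_exists[OF f]) (simp add: G_def XY)
  then obtain X a W where ch: "chain f G X a W" by blast
  note c = chainD[OF ch]
  have "\<exists>n. \<forall>m\<ge>n. W m \<subseteq> f Z" if Z: "Z \<in> fin_sets V" for Z
  proof -
    have "finite (\<Union>v\<in>Z. {i. v \<in> f (X0 \<union> Y i)})" using fin Z unfolding fin_sets_def by auto
    then obtain i where i: "i \<notin> (\<Union>v\<in>Z. {i. v \<in> f (X0 \<union> Y i)})"
      using ex_new_if_finite infinite_UNIV_nat by blast
    then have dj: "f (X0 \<union> Y i) \<inter> Z = {}" by auto
    have XYZ: "X0 \<union> Y i \<union> Z \<in> fin_sets V" by (rule fin_sets_Un[OF XY Z])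
    obtain u where "u \<in> f (X0 \<union> Y i \<union> Z)" using directionD(3)[OF f XYZ] by blast
    then have "u \<in> f (X0 \<union> Y i)" "u \<in> f Z"
      using direction_mono[OF f XYZ, of "X0 \<union> Y i"] direction_mono[OF f XYZ, of Z] by auto
    then have sub: "f (X0 \<union> Y i) \<subseteq> f Z"
      using comp_subset_comp[OF directionD(1)[OF f XY] dj directionD(1)[OF f Z]] by blast
    have "W m \<subseteq> f Z" if "m \<ge> Suc i" for m
    proof -
      have "X0 \<union> Y i \<subseteq> X m" using c(9)[of i] chain_mono[OF ch that] unfolding G_def by auto
      then show ?thesis using direction_mono[OF f c(1)[of m]] c(4)[of m] sub by blast
    qed
    then show ?thesis by blast
  qed
  then show ?thesis by (rule chain_ray[OF f ch])
qed

text \<open>The two preceding lemmas exhaust all cases: hitting sets always exist, or some pair of a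
  finite set and a vertex has none.\<close>

lemma direction_end:
  assumes f: "direction f"
  obtains \<omega> where "\<omega> \<in> ends V E" "\<And>X. X \<in> fin_sets V \<Longrightarrow> comp V E X \<omega> = f X"
proof -
  obtain r where r: "ray V E r" "\<forall>Y\<in>fin_sets V. tail_in r (f Y)"
    using direction_ray_hit[OF f] direction_ray_no_hit[OF f] by metis
  then have sr: "solid_ray V E r" using directionD(1)[OF f] unfolding solid_ray_def by blast
  define \<omega> where "\<omega> = {s. ray_equiv V E r s}"
  have \<omega>: "\<omega> \<in> ends V E" using sr unfolding \<omega>_def ends_def by blast
  have "r \<in> \<omega>" using sr unfolding \<omega>_def ray_equiv_def solid_ray_def by auto
  then show thesis
    using that[OF \<omega>] comp_eqI[OF \<omega> directionD(1)[OF f]] r(2) by blast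
qed

end

section \<open>Surjectivity and the homeomorphism\<close>

context solid_digraph
begin

section \<open>Nodes from threads of classes\<close>

lemma empty_fin: "{} \<in> fin_sets V"
  unfolding fin_sets_def by simp

lemma fin_sets_subset: "X' \<in> fin_sets V \<Longrightarrow> X \<subseteq> X' \<Longrightarrow> X \<in> fin_sets V"
  unfolding fin_sets_def using finite_subset by auto

text \<open>If some \<open>c X\<close> is a singleton \<open>{v}\<close>, then \<open>v\<close> lies
  in every \<open>c X'\<close>, because \<open>c (X \<union> X')\<close> is a nonempty subset of
  both. Otherwise every \<open>c X\<close> is a strong component, so \<open>c\<close> is a direction
  and comes from an end.\<close>

lemma thread_node:
  assumes c: "\<And>X. X \<in> fin_sets V \<Longrightarrow> c X \<in> parts X"
    and mono: "\<And>X X'. X' \<in> fin_sets V \<Longrightarrow> X \<subseteq> X' \<Longrightarrow> c X' \<subseteq> c X"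
  obtains n where "n \<in> nodes" "\<And>X. X \<in> fin_sets V \<Longrightarrow> nimg (parts X) n = c X"
proof (cases "\<exists>X\<in>fin_sets V. \<exists>v. c X = {v}")
  case True
  then obtain X v where X: "X \<in> fin_sets V" "c X = {v}" by blast
  have v: "v \<in> V" using partition_subset[OF parts_partition[OF X(1)] c[OF X(1)]] X(2) by simp
  have "nimg (parts X') (Inl v) = c X'" if X': "X' \<in> fin_sets V" for X'
  proof -
    have U: "X \<union> X' \<in> fin_sets V" by (rule fin_sets_Un[OF X(1) X'])
    obtain u where u: "u \<in> c (X \<union> X')" using partition_nonempty[OF parts_partition[OF U] c[OF U]] by blast
    have "v \<in> c X'" using mono[OF U, of X] mono[OF U, of X'] X(2) u by auto
    then show ?thesis using cls_eq[OF parts_partition[OF X'] c[OF X']] by (simp add: nimg_Inl)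
  qed
  moreover have "Inl v \<in> nodes" using v unfolding nodes_def by simp
  ultimately show thesis using that by blast
next
  case False
  have C: "c X \<in> strong_comps V E X" if "X \<in> fin_sets V" for X
    using c[OF that] False that unfolding parts_def by auto
  then have "direction c" using mono unfolding direction_def by simp
  then obtain \<omega> where \<omega>: "\<omega> \<in> ends V E" "\<And>X. X \<in> fin_sets V \<Longrightarrow> comp V E X \<omega> = c X"
    by (rule direction_end) blast
  moreover have "Inr \<omega> \<in> nodes" using \<omega>(1) unfolding nodes_def by simp
  ultimately show thesis using that[of "Inr \<omega>"] nimg_parts_end by simp
qed

text \<open>The tails and heads of the image edges of an inner point are known only above some
  \<open>X0\<close>. Such a thread is extended to all \<open>X\<close> by passing to the class of
  \<open>parts X\<close> that contains \<open>c (X \<union> X0)\<close>.\<close>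

lemma thread_node_from:
  assumes X0: "X0 \<in> fin_sets V"
    and c: "\<And>X. X \<in> fin_sets V \<Longrightarrow> X0 \<subseteq> X \<Longrightarrow> c X \<in> parts X"
    and mono: "\<And>X X'. X' \<in> fin_sets V \<Longrightarrow> X0 \<subseteq> X \<Longrightarrow> X \<subseteq> X' \<Longrightarrow> c X' \<subseteq> c X"
  obtains n where "n \<in> nodes" "\<And>X. X \<in> fin_sets V \<Longrightarrow> X0 \<subseteq> X \<Longrightarrow> nimg (parts X) n = c X"
proof -
  define c' where "c' X = super (parts X) (c (X \<union> X0))" for X
  have U: "X \<union> X0 \<in> fin_sets V" if "X \<in> fin_sets V" for X using fin_sets_Un[OF that X0] .
  have c': "c' X \<in> parts X" "c (X \<union> X0) \<subseteq> c' X" if X: "X \<in> fin_sets V" for X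
    unfolding c'_def
    using super_in[OF parts_partition[OF U[OF X]] parts_partition[OF X]
        parts_mono[OF Un_upper1 U[OF X]] c[OF U[OF X] Un_upper2]] .
  have mono': "c' X' \<subseteq> c' X" if X': "X' \<in> fin_sets V" and sub: "X \<subseteq> X'" for X X'
  proof -
    have X: "X \<in> fin_sets V" by (rule fin_sets_subset[OF X' sub])
    obtain p where p: "p \<in> parts X" "c' X' \<subseteq> p"
      using parts_mono[OF sub X'] c'(1)[OF X'] unfolding refines_def by blast
    obtain u where u: "u \<in> c (X' \<union> X0)"
      using partition_nonempty[OF parts_partition[OF U[OF X']] c[OF U[OF X'] Un_upper2]] by auto
    have "c (X' \<union> X0) \<subseteq> c (X \<union> X0)" by (rule mono[OF U[OF X']]) (use sub in auto)
    then have "u \<in> c' X" "u \<in> p" using u c'(2)[OF X] c'(2)[OF X'] p(2) by auto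
    then have "p = c' X" using partition_eqI[OF parts_partition[OF X] p(1) c'(1)[OF X]] by simp
    then show ?thesis using p(2) by simp
  qed
  obtain n where n: "n \<in> nodes" "\<And>X. X \<in> fin_sets V \<Longrightarrow> nimg (parts X) n = c' X"
    using thread_node[of c', OF c'(1) mono'] by blast
  have "c' X = c X" if X: "X \<in> fin_sets V" "X0 \<subseteq> X" for X
  proof -
    have "X \<union> X0 = X" using X(2) by auto
    then show ?thesis
      unfolding c'_def using super_eq[OF parts_partition[OF X(1)] parts_partition[OF X(1)] c[OF X] c[OF X]]
      by simp
  qed
  then show thesis using that[OF n(1)] n(2) by simp
qed

section \<open>Compatible families and their preimages\<close>

definition compat :: "('v set set \<Rightarrow> 'v qpoint) \<Rightarrow> bool" where
  "compat x \<longleftrightarrow> (\<forall>P\<in>adm_parts V E. x P \<in> qpoints P) \<and>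
     (\<forall>P\<in>adm_parts V E. \<forall>P'\<in>adm_parts V E. refines P' P \<longrightarrow> fmap V E P' P (x P') = x P)"

lemma compat_parts:
  assumes "compat x" "X' \<in> fin_sets V" "X \<subseteq> X'"
  shows "fmap V E (parts X') (parts X) (x (parts X')) = x (parts X)"
  using assms parts_adm fin_sets_subset[OF assms(2,3)] parts_mono[OF assms(3,2)]
  unfolding compat_def by simp

text \<open>By cofinality every \<open>P\<close> is refined by some \<open>parts X\<close> with
  \<open>X0 \<subseteq> X\<close>, and the bonding map transports the equality from there to
  \<open>P\<close>.\<close>

lemma phi_eq_from:
  assumes x: "compat x" and y: "y \<in> points" and X0: "X0 \<in> fin_sets V"
    and eq: "\<And>X. X \<in> fin_sets V \<Longrightarrow> X0 \<subseteq> X \<Longrightarrow> phi V E (parts X) y = x (parts X)"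
    and P: "P \<in> adm_parts V E"
  shows "phi V E P y = x P"
proof -
  obtain X1 where X1: "X1 \<in> fin_sets V" "\<And>X'. X' \<in> fin_sets V \<Longrightarrow> X1 \<subseteq> X' \<Longrightarrow> refines (parts X') P"
    using parts_cofinal[OF P] by blast
  define X where "X = X0 \<union> X1"
  have X: "X \<in> fin_sets V" "X0 \<subseteq> X" "X1 \<subseteq> X" using fin_sets_Un[OF X0 X1(1)] unfolding X_def by auto
  note ref = X1(2)[OF X(1,3)]
  have "phi V E P y = fmap V E (parts X) P (phi V E (parts X) y)"
    using fmap_phi[OF P parts_adm[OF X(1)] ref y] by simp
  also have "\<dots> = x P" using eq[OF X(1,2)] x P parts_adm[OF X(1)] ref unfolding compat_def by simp
  finally show ?thesis .
qed

lemma fmap_QI: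
  assumes P: "P \<in> adm_parts V E" and P': "P' \<in> adm_parts V E" and ref: "refines P' P"
    and q: "q \<in> qedges V E P'" and q': "q' \<in> qedges V E P"
    and eq: "fmap V E P' P (QI q t) = QI q' t'"
  shows "t' = t" "qtail P q' = super P (qtail P' q)" "qhead P q' = super P (qhead P' q)"
    "\<And>e. q' = QE e \<Longrightarrow> q = QE e"
proof -
  define p1 where "p1 = super P (qtail P' q)"
  define p2 where "p2 = super P (qhead P' q)"
  note part = adm_partition[OF P] adm_partition[OF P']
  have ne: "p1 \<noteq> p2" and alt: "QQ p1 p2 \<in> qedges V E P \<and> q' = QQ p1 p2 \<and> t' = t \<or>
      QQ p1 p2 \<notin> qedges V E P \<and> q' = q \<and> t' = t"
  proof -
    have "(if p1 = p2 then QV p1 else if QQ p1 p2 \<in> qedges V E P then QI (QQ p1 p2) t else QI q t) = QI q' t'"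
      using eq unfolding fmap_def Let_def p1_def p2_def by simp
    then show "p1 \<noteq> p2" "QQ p1 p2 \<in> qedges V E P \<and> q' = QQ p1 p2 \<and> t' = t \<or>
      QQ p1 p2 \<notin> qedges V E P \<and> q' = q \<and> t' = t"
      by (simp_all split: if_splits)
  qed
  have "t' = t \<and> qtail P q' = p1 \<and> qhead P q' = p2 \<and> (\<forall>e. q' = QE e \<longrightarrow> q = QE e)"
  proof (cases "QQ p1 p2 \<in> qedges V E P")
    case True
    then show ?thesis using alt unfolding qtail_def qhead_def by auto
  next
    case False
    then have qq: "q' = q" "t' = t" using alt by auto
    have "qtail P q' = p1 \<and> qhead P q' = p2"
    proof (cases q)
      case (QE e)
      then obtain u w where uw: "q = QE (u, w)" "(u, w) \<in> E" using q unfolding qedges_def by auto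
      then have "Inl u \<in> nodes" "Inl w \<in> nodes" using edge_in unfolding nodes_def by auto
      then have "super P (cls P' u) = cls P u" "super P (cls P' w) = cls P w"
        using super_nimg[OF P P' ref] by (auto simp flip: nimg_Inl)
      then show ?thesis using uw qq unfolding p1_def p2_def qtail_def qhead_def by simp
    next
      \<comment> \<open>Here \<open>q\<close> is an edge of both quotients, so its two classes
        belong to both partitions and \<open>super\<close> fixes them.\<close>
      case (QQ a b)
      then have "a \<in> P" "b \<in> P" "a \<in> P'" "b \<in> P'" using q q' qq unfolding qedges_def by auto
      then have "super P a = a" "super P b = b" using super_eq[OF part(2,1)] by auto
      then show ?thesis using QQ qq unfolding p1_def p2_def qtail_def qhead_def by simp
    qed
    then show ?thesis using qq by simp
  qed
  then show "t' = t" "qtail P q' = super P (qtail P' q)" "qhead P q' = super P (qhead P' q)"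
    "\<And>e. q' = QE e \<Longrightarrow> q = QE e" unfolding p1_def p2_def by auto
qed

text \<open>Between two ends the hypothesis is the definition. For a vertex \<open>v\<close> and an
  end \<omega> apply it to \<open>X \<union> {v}\<close>: the class of \<open>v\<close> becomes
  \<open>{v}\<close> and that of \<omega> shrinks within \<open>comp V E X \<omega>\<close>.\<close>

lemma limit_edgeI:
  assumes nm: "n \<in> nodes" "m \<in> nodes" "n \<noteq> m"
    and edge: "\<And>X. X \<in> fin_sets V \<Longrightarrow> has_edge E (nimg (parts X) n) (nimg (parts X) m)"
    and noE: "\<not> (\<exists>u w. n = Inl u \<and> m = Inl w)"
  shows "(n, m) \<in> limit_edges V E"
proof -
  have ve: "has_edge E {v} (comp V E X \<omega>)"
    if "n = Inl v" "m = Inr \<omega>" "X \<in> fin_sets V" for v \<omega> X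
  proof -
    have v: "v \<in> V" "\<omega> \<in> ends V E" using nm that unfolding nodes_def by auto
    then have X': "X \<union> {v} \<in> fin_sets V" using that(3) unfolding fin_sets_def by auto
    have "nimg (parts (X \<union> {v})) n = {v}" using nimg_parts_vertex[OF X' _ nm(1), of v] that(1) by simp
    moreover have "nimg (parts (X \<union> {v})) m \<subseteq> comp V E X \<omega>"
      using nimg_refines[OF parts_adm[OF that(3)] parts_adm[OF X'] parts_mono[OF _ X'] nm(2)]
        nimg_parts_end[OF that(3) v(2)] that(2) by auto
    ultimately show ?thesis using edge[OF X'] unfolding has_edge_def by auto
  qed
  have ev: "has_edge E (comp V E X \<omega>) {v}"
    if "m = Inl v" "n = Inr \<omega>" "X \<in> fin_sets V" for v \<omega> X
  proof -
    have v: "v \<in> V" "\<omega> \<in> ends V E" using nm that unfolding nodes_def by auto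
    then have X': "X \<union> {v} \<in> fin_sets V" using that(3) unfolding fin_sets_def by auto
    have "nimg (parts (X \<union> {v})) m = {v}" using nimg_parts_vertex[OF X' _ nm(2), of v] that(1) by simp
    moreover have "nimg (parts (X \<union> {v})) n \<subseteq> comp V E X \<omega>"
      using nimg_refines[OF parts_adm[OF that(3)] parts_adm[OF X'] parts_mono[OF _ X'] nm(1)]
        nimg_parts_end[OF that(3) v(2)] that(2) by auto
    ultimately show ?thesis using edge[OF X'] unfolding has_edge_def by auto
  qed
  have ee: "has_edge E (comp V E X \<omega>) (comp V E X \<eta>)"
    if "n = Inr \<omega>" "m = Inr \<eta>" "X \<in> fin_sets V" for \<omega> \<eta> X
  proof -
    have "\<omega> \<in> ends V E" "\<eta> \<in> ends V E" using nm that unfolding nodes_def by auto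
    then show ?thesis using edge[OF that(3)] nimg_parts_end[OF that(3)] that(1,2) by simp
  qed
  show ?thesis
  proof (cases n)
    case n: (Inl v)
    then obtain \<omega> where m: "m = Inr \<omega>" using noE by (cases m) auto
    have "v \<in> V" "\<omega> \<in> ends V E" using nm n m unfolding nodes_def by auto
    then show ?thesis using ve[OF n m] unfolding limit_edges_def n m by blast
  next
    case n: (Inr \<omega>)
    show ?thesis
    proof (cases m)
      case m: (Inl v)
      have "v \<in> V" "\<omega> \<in> ends V E" using nm n m unfolding nodes_def by auto
      then show ?thesis using ev[OF m n] unfolding limit_edges_def n m by blast
    next
      case m: (Inr \<eta>)
      have "\<omega> \<in> ends V E" "\<eta> \<in> ends V E" "\<omega> \<noteq> \<eta>" using nm n m unfolding nodes_def by auto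
      then show ?thesis using ee[OF n m] unfolding limit_edges_def n m by blast
    qed
  qed
qed

text \<open>The vertex coordinates form a thread of classes, and \<open>thread_node\<close> supplies
  the node.\<close>

lemma compat_vertices_preimage:
  assumes x: "compat x" and v: "\<And>X. X \<in> fin_sets V \<Longrightarrow> \<exists>p. x (parts X) = QV p"
  shows "\<exists>y\<in>points. \<forall>P\<in>adm_parts V E. phi V E P y = x P"
proof -
  define c where "c X = (THE p. x (parts X) = QV p)" for X
  have c: "x (parts X) = QV (c X)" if "X \<in> fin_sets V" for X
    using v[OF that] unfolding c_def by auto
  have cP: "c X \<in> parts X" if "X \<in> fin_sets V" for X
    using x parts_adm[OF that] c[OF that] unfolding compat_def qpoints_def by force
  have mono: "c X' \<subseteq> c X" if X': "X' \<in> fin_sets V" "X \<subseteq> X'" for X X'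
  proof -
    have X: "X \<in> fin_sets V" by (rule fin_sets_subset[OF X'])
    have "super (parts X) (c X') = c X"
      using compat_parts[OF x X'] c[OF X] c[OF X'(1)] unfolding fmap_def by simp
    then show ?thesis
      using super_in(2)[OF parts_partition[OF X'(1)] parts_partition[OF X] parts_mono[OF X'(2,1)] cP[OF X'(1)]]
      by simp
  qed
  obtain n where n: "n \<in> nodes" "\<And>X. X \<in> fin_sets V \<Longrightarrow> nimg (parts X) n = c X"
    using thread_node[of c, OF cP mono] by blast
  have y: "DNode n \<in> points" using n(1) unfolding points_def by simp
  have "phi V E P (DNode n) = x P" if "P \<in> adm_parts V E" for P
    by (rule phi_eq_from[OF x y empty_fin _ that]) (simp add: phi_DNode n(2) c)
  then show ?thesis using y by blast
qed

text \<open>Above an inner coordinate all coordinates are inner with the same parameter, and the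
  tails and heads of their edges form threads with nodes \<open>n\<close> and \<open>m\<close>. If
  an edge copy occurs at some stage, it persists and \<open>(n, m)\<close> is that edge of
  \<open>D\<close>; otherwise quotient edges occur throughout and \<open>(n, m)\<close> is a limit
  edge.\<close>

lemma compat_inner_preimage:
  assumes x: "compat x" and X0: "X0 \<in> fin_sets V" and x0: "x (parts X0) = QI q0 t0"
  shows "\<exists>y\<in>points. \<forall>P\<in>adm_parts V E. phi V E P y = x P"
proof -
  have qp: "x (parts X) \<in> qpoints (parts X)" if "X \<in> fin_sets V" for X
    using x parts_adm[OF that] unfolding compat_def by simp
  have q0: "q0 \<in> qedges V E (parts X0)" and t0: "0 < t0" "t0 < 1"
    using qp[OF X0] x0 unfolding qpoints_def by auto
  define q where "q X = (THE q. x (parts X) = QI q t0)" for X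
  have q: "x (parts X) = QI (q X) t0 \<and> q X \<in> qedges V E (parts X)"
    if X: "X \<in> fin_sets V" "X0 \<subseteq> X" for X
  proof -
    have *: "fmap V E (parts X) (parts X0) (x (parts X)) = QI q0 t0"
      using compat_parts[OF x X] x0 by simp
    show ?thesis
    proof (cases "x (parts X)")
      case (QV p)
      then show ?thesis using * unfolding fmap_def by simp
    next
      case (QI q' t)
      then have q': "q' \<in> qedges V E (parts X)" using qp[OF X(1)] unfolding qpoints_def by auto
      have "t0 = t"
        using fmap_QI(1)[OF parts_adm[OF X0] parts_adm[OF X(1)] parts_mono[OF X(2,1)] q' q0] * QI by simp
      then show ?thesis using QI q' unfolding q_def by simp
    qed
  qed
  have step: "qtail (parts X) (q X) = super (parts X) (qtail (parts X') (q X'))"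
      "qhead (parts X) (q X) = super (parts X) (qhead (parts X') (q X'))"
      "\<And>e. q X = QE e \<Longrightarrow> q X' = QE e"
    if X': "X' \<in> fin_sets V" "X0 \<subseteq> X" "X \<subseteq> X'" for X X'
  proof -
    have X: "X \<in> fin_sets V" by (rule fin_sets_subset[OF X'(1,3)])
    have X0': "X0 \<subseteq> X'" using X'(2,3) by auto
    have eq: "fmap V E (parts X') (parts X) (QI (q X') t0) = QI (q X) t0"
      using compat_parts[OF x X'(1,3)] q[OF X X'(2)] q[OF X'(1) X0'] by simp
    note * = fmap_QI[OF parts_adm[OF X] parts_adm[OF X'(1)] parts_mono[OF X'(3,1)]
        q[OF X'(1) X0', THEN conjunct2] q[OF X X'(2), THEN conjunct2] eq]
    show "qtail (parts X) (q X) = super (parts X) (qtail (parts X') (q X'))"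
      "qhead (parts X) (q X) = super (parts X) (qhead (parts X') (q X'))"
      "\<And>e. q X = QE e \<Longrightarrow> q X' = QE e" using *(2-4) by auto
  qed
  have ends: "qtail (parts X) (q X) \<in> parts X" "qhead (parts X) (q X) \<in> parts X"
      "qtail (parts X) (q X) \<noteq> qhead (parts X) (q X)"
    if X: "X \<in> fin_sets V" "X0 \<subseteq> X" for X
    using qedges_ends[OF parts_partition[OF X(1)]] q[OF X] by auto
  have mono: "qtail (parts X') (q X') \<subseteq> qtail (parts X) (q X)"
      "qhead (parts X') (q X') \<subseteq> qhead (parts X) (q X)"
    if X': "X' \<in> fin_sets V" "X0 \<subseteq> X" "X \<subseteq> X'" for X X'
  proof -
    have X: "X \<in> fin_sets V" by (rule fin_sets_subset[OF X'(1,3)])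
    have X0': "X0 \<subseteq> X'" using X'(2,3) by auto
    note * = super_in(2)[OF parts_partition[OF X'(1)] parts_partition[OF X] parts_mono[OF X'(3,1)]]
    show "qtail (parts X') (q X') \<subseteq> qtail (parts X) (q X)"
      using *[OF ends(1)[OF X'(1) X0']] step(1)[OF X'] by simp
    show "qhead (parts X') (q X') \<subseteq> qhead (parts X) (q X)"
      using *[OF ends(2)[OF X'(1) X0']] step(2)[OF X'] by simp
  qed
  obtain n where n: "n \<in> nodes"
    "\<And>X. X \<in> fin_sets V \<Longrightarrow> X0 \<subseteq> X \<Longrightarrow> nimg (parts X) n = qtail (parts X) (q X)"
    using thread_node_from[of X0 "\<lambda>X. qtail (parts X) (q X)", OF X0 ends(1) mono(1)] by blast
  obtain m where m: "m \<in> nodes"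
    "\<And>X. X \<in> fin_sets V \<Longrightarrow> X0 \<subseteq> X \<Longrightarrow> nimg (parts X) m = qhead (parts X) (q X)"
    using thread_node_from[of X0 "\<lambda>X. qhead (parts X) (q X)", OF X0 ends(2) mono(2)] by blast
  have nm: "n \<noteq> m" using n(2)[OF X0] m(2)[OF X0] ends(3)[OF X0] by auto
  \<comment> \<open>The extra bound \<open>X1\<close> is for the case of an edge copy, where
    \<open>q X\<close> is identified only above the stage at which the copy appears.\<close>
  have main: ?thesis if X1: "X1 \<in> fin_sets V" "X0 \<subseteq> X1" and e: "(n, m) \<in> all_edges V E"
    and img: "\<And>X. X \<in> fin_sets V \<Longrightarrow> X1 \<subseteq> X \<Longrightarrow> qimg (parts X) (n, m) = q X" for X1
  proof -
    have y: "DInner (n, m) t0 \<in> points" using e t0 by (simp add: DInner_points)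
    have "phi V E (parts X) (DInner (n, m) t0) = x (parts X)" if X: "X \<in> fin_sets V" "X1 \<subseteq> X" for X
    proof -
      have X0': "X0 \<subseteq> X" using X1 X by auto
      show ?thesis
        using phi_DInner[OF parts_adm[OF X(1)] e] n(2)[OF X(1) X0'] m(2)[OF X(1) X0']
          ends(3)[OF X(1) X0'] img[OF X] q[OF X(1) X0'] by simp
    qed
    then show ?thesis using phi_eq_from[OF x y X1(1)] y by blast
  qed
  show ?thesis
  proof (cases "\<exists>X1\<in>fin_sets V. X0 \<subseteq> X1 \<and> (\<exists>u w. q X1 = QE (u, w))")
    case True
    then obtain X1 u w where X1: "X1 \<in> fin_sets V" "X0 \<subseteq> X1" "q X1 = QE (u, w)" by blast
    then have uw: "(u, w) \<in> E" using q unfolding qedges_def by force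
    have qX: "q X = QE (u, w)" if "X \<in> fin_sets V" "X1 \<subseteq> X" for X
      using step(3)[OF that(1) X1(2) that(2) X1(3)] .
    \<comment> \<open>Adding the endpoints makes their classes singletons, which identifies
      \<open>n\<close> and \<open>m\<close>.\<close>
    define X2 where "X2 = X1 \<union> {u, w}"
    have X2: "X2 \<in> fin_sets V" "X0 \<subseteq> X2" "X1 \<subseteq> X2" "u \<in> X2" "w \<in> X2"
      using X1 edge_in[OF uw] unfolding X2_def fin_sets_def by auto
    have nodes: "Inl u \<in> nodes" "Inl w \<in> nodes" using edge_in[OF uw] unfolding nodes_def by auto
    have "nimg (parts X2) n = nimg (parts X2) (Inl u)" "nimg (parts X2) m = nimg (parts X2) (Inl w)"
      using n(2)[OF X2(1,2)] m(2)[OF X2(1,2)] qX[OF X2(1,3)] by (auto simp: qtail_def qhead_def nimg_Inl)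
    then have e: "n = Inl u" "m = Inl w"
      using nimg_parts_vertex[OF X2(1)] X2(4,5) n(1) m(1) nodes by metis+
    have "qimg (parts X) (n, m) = q X" if X: "X \<in> fin_sets V" "X1 \<subseteq> X" for X
    proof -
      have "QE (u, w) \<in> qedges V E (parts X)" using q[OF X(1)] X1(2) X(2) qX[OF X] by auto
      then have "finite (edges_between E (cls (parts X) u) (cls (parts X) w))" unfolding qedges_def by auto
      then have "QQ (cls (parts X) u) (cls (parts X) w) \<notin> qedges V E (parts X)" unfolding qedges_def by auto
      then show ?thesis using qX[OF X] e unfolding qimg_def by (simp add: nimg_Inl)
    qed
    moreover have "(n, m) \<in> all_edges V E" using e uw unfolding all_edges_def by auto
    ultimately show ?thesis using main[OF X1(1,2)] by blast
  next
    case False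
    have qX: "q X = QQ (nimg (parts X) n) (nimg (parts X) m)"
      "QQ (nimg (parts X) n) (nimg (parts X) m) \<in> qedges V E (parts X)"
      "infinite (edges_between E (nimg (parts X) n) (nimg (parts X) m))"
      if X: "X \<in> fin_sets V" "X0 \<subseteq> X" for X
    proof -
      have qe: "q X \<in> qedges V E (parts X)" using q[OF X] by simp
      moreover have "\<nexists>u w. q X = QE (u, w)" using False X by blast
      ultimately obtain a b where ab: "q X = QQ a b" "infinite (edges_between E a b)"
        unfolding qedges_def by auto
      then have "nimg (parts X) n = a" "nimg (parts X) m = b"
        using n(2)[OF X] m(2)[OF X] unfolding qtail_def qhead_def by auto
      then show "q X = QQ (nimg (parts X) n) (nimg (parts X) m)"
        "QQ (nimg (parts X) n) (nimg (parts X) m) \<in> qedges V E (parts X)"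
        "infinite (edges_between E (nimg (parts X) n) (nimg (parts X) m))" using ab qe by auto
    qed
    \<comment> \<open>Two vertices would eventually have singleton classes, with at most one edge
      between them, against the infinitely many under a quotient edge.\<close>
    have noE: "\<not> (\<exists>u w. n = Inl u \<and> m = Inl w)"
    proof
      assume "\<exists>u w. n = Inl u \<and> m = Inl w"
      then obtain u w where uw: "n = Inl u" "m = Inl w" by blast
      define X where "X = X0 \<union> {u, w}"
      have X: "X \<in> fin_sets V" "X0 \<subseteq> X" "u \<in> X" "w \<in> X"
        using X0 n(1) m(1) uw unfolding X_def fin_sets_def nodes_def by auto
      have "nimg (parts X) n = {u}" "nimg (parts X) m = {w}"
        using nimg_parts_vertex[OF X(1,3) n(1)] nimg_parts_vertex[OF X(1,4) m(1)] uw by auto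
      then have "infinite (edges_between E {u} {w})" using qX(3)[OF X(1,2)] by simp
      moreover have "edges_between E {u} {w} \<subseteq> {(u, w)}" unfolding edges_between_def by auto
      ultimately show False using finite_subset by blast
    qed
    have "has_edge E (nimg (parts X) n) (nimg (parts X) m)" if X: "X \<in> fin_sets V" for X
    proof -
      have U: "X \<union> X0 \<in> fin_sets V" by (rule fin_sets_Un[OF X X0])
      have "infinite (edges_between E (nimg (parts (X \<union> X0)) n) (nimg (parts (X \<union> X0)) m))"
        using qX(3)[OF U] by simp
      then have "edges_between E (nimg (parts (X \<union> X0)) n) (nimg (parts (X \<union> X0)) m) \<noteq> {}"
        by auto
      moreover have "nimg (parts (X \<union> X0)) k \<subseteq> nimg (parts X) k" if "k \<in> nodes" for k
        by (rule nimg_refines[OF parts_adm[OF X] parts_adm[OF U] parts_mono[OF _ U] that]) simp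
      ultimately show ?thesis
        using n(1) m(1) unfolding edges_between_def has_edge_def by blast
    qed
    then have "(n, m) \<in> all_edges V E"
      using limit_edgeI[OF n(1) m(1) nm _ noE] unfolding all_edges_def by blast
    moreover have "qimg (parts X) (n, m) = q X" if X: "X \<in> fin_sets V" "X0 \<subseteq> X" for X
      using qX[OF X] unfolding qimg_def by simp
    ultimately show ?thesis using main[OF X0 subset_refl] by blast
  qed
qed

lemma compat_preimage:
  assumes "compat x"
  shows "\<exists>y\<in>points. \<forall>P\<in>adm_parts V E. phi V E P y = x P"
proof (cases "\<forall>X\<in>fin_sets V. \<exists>p. x (parts X) = QV p")
  case True
  then show ?thesis using compat_vertices_preimage[OF assms] by blast
next
  case False
  then obtain X0 where X0: "X0 \<in> fin_sets V" "\<nexists>p. x (parts X0) = QV p" by blast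
  then obtain q0 t0 where "x (parts X0) = QI q0 t0" by (cases "x (parts X0)") auto
  then show ?thesis by (rule compat_inner_preimage[OF assms X0(1)])
qed

section \<open>\<open>Phi\<close> as a homeomorphism onto the inverse limit\<close>

lemma topspace_invlim:
  "topspace (invlim_top V E) = {x \<in> extensional (adm_parts V E). compat x}"
  unfolding invlim_top_def compat_def
  by (auto simp: topspace_QTop PiE_def)

lemma Phi_compat: "y \<in> points \<Longrightarrow> Phi V E y \<in> topspace (invlim_top V E)"
  unfolding topspace_invlim compat_def Phi_def using phi_in_qpoints fmap_phi by simp

lemma continuous_Phi: "continuous_map (DTop V E) (invlim_top V E) (Phi V E)"
proof -
  have "continuous_map (DTop V E) (product_topology (\<lambda>P. QTop V E P) (adm_parts V E)) (Phi V E)"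
    unfolding continuous_map_componentwise
  proof (intro conjI ballI)
    show "Phi V E ` topspace (DTop V E) \<subseteq> extensional (adm_parts V E)" unfolding Phi_def by auto
    fix P assume P: "P \<in> adm_parts V E"
    then have "(\<lambda>y. Phi V E y P) = phi V E P" unfolding Phi_def by auto
    then show "continuous_map (DTop V E) (QTop V E P) (\<lambda>y. Phi V E y P)"
      using continuous_phi[OF P] by simp
  qed
  then show ?thesis
    unfolding invlim_top_def continuous_map_in_subtopology
    using Phi_compat topspace_DTop unfolding invlim_top_def by auto
qed

lemma homeomorphic_Phi: "homeomorphic_map (DTop V E) (invlim_top V E) (Phi V E)"
proof -
  have inj: "inj_on (Phi V E) points"
    unfolding inj_on_def Phi_def using phi_inj by (metis restrict_apply')
  have surj: "x \<in> Phi V E ` points" if x: "x \<in> topspace (invlim_top V E)" for x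
  proof -
    obtain y where y: "y \<in> points" "\<forall>P\<in>adm_parts V E. phi V E P y = x P"
      using compat_preimage x unfolding topspace_invlim by blast
    have "Phi V E y = x"
      using x y(2) unfolding topspace_invlim Phi_def by (intro extensionalityI[of _ "adm_parts V E"]) auto
    then show ?thesis using y(1) by blast
  qed
  define g where "g = inv_into points (Phi V E)"
  have gP: "g x \<in> points" "Phi V E (g x) = x" if "x \<in> topspace (invlim_top V E)" for x
    unfolding g_def using inv_into_into[OF surj[OF that]] f_inv_into_f[OF surj[OF that]] by auto
  have "continuous_map (invlim_top V E) (DTop V E) g"
    unfolding DTop_def
  proof (rule continuous_on_generated_topo)
    fix G assume "G \<in> gen_sets V E"
    then obtain P U where PU: "P \<in> adm_parts V E" "openin (QTop V E P) U" "G = preim P U"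
      by (rule generator_preim)
    \<comment> \<open>Applying \<open>g\<close> and then \<open>phi\<close> at \<open>P\<close> is
      the projection to coordinate \<open>P\<close>, so the preimage of a generator under
      \<open>g\<close> is an open cylinder.\<close>
    have "phi V E P (g x) = x P" if "x \<in> topspace (invlim_top V E)" for x
      using fun_cong[OF gP(2)[OF that], of P] PU(1) unfolding Phi_def by simp
    then have "g -` G \<inter> topspace (invlim_top V E) = {x \<in> topspace (invlim_top V E). x P \<in> U}"
      using gP(1) unfolding PU(3) preim_def by auto
    moreover have "continuous_map (invlim_top V E) (QTop V E P) (\<lambda>x. x P)"
      unfolding invlim_top_def
      by (intro continuous_map_from_subtopology continuous_map_product_projection PU(1))
    ultimately show "openin (invlim_top V E) (g -` G \<inter> topspace (invlim_top V E))"
      using openin_continuous_map_preimage[OF _ PU(2)] by simp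
  next
    show "g ` topspace (invlim_top V E) \<subseteq> \<Union>(gen_sets V E)"
      using gP(1) topspace_DTop unfolding DTop_def topology_generated_by_topspace by auto
  qed
  then have "homeomorphic_maps (DTop V E) (invlim_top V E) (Phi V E) g"
    unfolding homeomorphic_maps_def topspace_DTop using continuous_Phi gP(2) inj
    by (simp add: g_def)
  then show ?thesis using homeomorphic_maps_map by blast
qed

end

theorem theorem2:
  fixes V :: "'v set" and E :: "('v \<times> 'v) set"
  assumes "digraph V E" and "solid V E"
  shows "homeomorphic_map (DTop V E) (invlim_top V E) (Phi V E)"
proof -
  interpret solid_digraph V E
    using assms by unfold_locales
  show ?thesis by (rule homeomorphic_Phi)
qed

end
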